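(* Let $a,b\in\mathbb{R}$, $2\psi\in(0,\pi)$, $\nu>0$, $\beta\in\mathbb{R}$, let $\phi\in[-\pi,\pi]$ be fixed and suppose $f\in H^{\beta,\infty}(\mathbb{R}^2)$. Then $\mathcal{V}_Lf(\cdot,\phi)\in H^{\alpha,2}(\mathbb{R}^2)$ for any $\alpha<\beta-1/2$.
   Context: Fourier transform: $\hat f(\xi)=\mathcal{F}f(\xi)=\int e^{-i\mathbf{x}\cdot\xi}f(\mathbf{x})\,d\mathbf{x}$. For $\alpha\in\mathbb{R}$, $1\le p\le\infty$, $H^{\alpha,p}(\mathbb{R}^n)$ is the space of tempered distributions $f$ whose Fourier transform is a measurable function with $\|f\|_{H^{\alpha,p}(\mathbb{R}^n)}=\|(1+|\xi|^2)^{\alpha/2}\hat f\|_{L^p(\mathbb{R}^n)}<\infty$. The finite-length V-line transform is $$\mathcal{V}_Lf(\mathbf{x},\phi)=a\int_0^\nu f(\mathbf{x}+t\Phi)\,dt+b\int_0^\nu f(\mathbf{x}+t\Phi')\,dt,$$ where $\Phi=(\cos(\phi+2\psi-\pi/2),\sin(\phi+2\psi-\pi/2))$ and $\Phi'=(\cos(\phi-\pi/2),\sin(\phi-\pi/2))$. Equivalently (and this is its meaning for tempered $f$ with $\hat f$ a function), for fixed $\phi$ its Fourier transform in $\mathbf{x}$ is $\hat f(\xi)\,(a\,m(\xi\cdot\Phi)+b\,m(\xi\cdot\Phi'))$ with $m(y)=\int_0^\nu e^{ity}\,dt$. *)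

theory Defs
  imports "HOL-Probability.Essential_Supremum"
begin

section \<open>Schwartz functions\<close>

text \<open>Multi-indices are represented by lists of basis vectors.\<close>

primrec iter_partial ::
  "'a list \<Rightarrow> ('a::euclidean_space \<Rightarrow> complex) \<Rightarrow> 'a \<Rightarrow> complex" where
  "iter_partial [] \<eta> = \<eta>"
| "iter_partial (v # vs) \<eta> = (\<lambda>x. frechet_derivative (iter_partial vs \<eta>) (at x) v)"

definition schwartz :: "('a::euclidean_space \<Rightarrow> complex) set" where
  "schwartz = {\<eta>. \<forall>vs. set vs \<subseteq> Basis \<longrightarrow>
      iter_partial vs \<eta> differentiable_on UNIV \<and>
      (\<forall>k::nat. bounded (range (\<lambda>x. (1 + norm x) ^ k *\<^sub>R iter_partial vs \<eta> x)))}"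

definition schwartz_seminorm ::
  "nat \<Rightarrow> 'a list \<Rightarrow> ('a::euclidean_space \<Rightarrow> complex) \<Rightarrow> real" where
  "schwartz_seminorm k vs \<eta> = (SUP x. (1 + norm x) ^ k * norm (iter_partial vs \<eta> x))"


section \<open>Tempered distributions\<close>

text \<open>The Schwartz space is metrizable, so sequential continuity at \<open>0\<close> is continuity for a linear
  functional. Functionals live on the full function type and are normalised to be \<open>undefined\<close>
  outside \<^const>\<open>schwartz\<close>, so that equality of functionals is equality of distributions.\<close>

definition tempered :: "(('a::euclidean_space \<Rightarrow> complex) \<Rightarrow> complex) set" where
  "tempered = {T. T \<in> extensional schwartz \<and>
      (\<forall>\<eta>\<in>schwartz. \<forall>\<zeta>\<in>schwartz. T (\<lambda>x. \<eta> x + \<zeta> x) = T \<eta> + T \<zeta>) \<and>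
      (\<forall>c. \<forall>\<eta>\<in>schwartz. T (\<lambda>x. c * \<eta> x) = c * T \<eta>) \<and>
      (\<forall>X. (\<forall>j::nat. X j \<in> schwartz) \<longrightarrow>
           (\<forall>k vs. set vs \<subseteq> Basis \<longrightarrow> (\<lambda>j. schwartz_seminorm k vs (X j)) \<longlonglongrightarrow> 0) \<longrightarrow>
           (\<lambda>j. T (X j)) \<longlonglongrightarrow> 0)}"

definition fourier :: "('a::euclidean_space \<Rightarrow> complex) \<Rightarrow> 'a \<Rightarrow> complex" where
  "fourier \<eta> \<xi> = (LINT x|lborel. exp (- (\<i> * of_real (x \<bullet> \<xi>))) * \<eta> x)"

definition fourier_distr ::
  "(('a::euclidean_space \<Rightarrow> complex) \<Rightarrow> complex) \<Rightarrow> ('a \<Rightarrow> complex) \<Rightarrow> complex" where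
  "fourier_distr T = (\<lambda>\<eta>\<in>schwartz. T (fourier \<eta>))"

text \<open>Meaningful for smooth \<open>h\<close> all of whose derivatives grow at most polynomially.\<close>

definition mult_distr :: "('a::euclidean_space \<Rightarrow> complex) \<Rightarrow>
    (('a \<Rightarrow> complex) \<Rightarrow> complex) \<Rightarrow> ('a \<Rightarrow> complex) \<Rightarrow> complex" where
  "mult_distr h T = (\<lambda>\<eta>\<in>schwartz. T (\<lambda>\<xi>. h \<xi> * \<eta> \<xi>))"

text \<open>The distribution \<open>T\<close> is the measurable function \<open>g\<close>.\<close>

definition is_function_distr ::
  "(('a::euclidean_space \<Rightarrow> complex) \<Rightarrow> complex) \<Rightarrow> ('a \<Rightarrow> complex) \<Rightarrow> bool" where
  "is_function_distr T g \<longleftrightarrow> g \<in> borel_measurable lborel \<and>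
     (\<forall>\<eta>\<in>schwartz. integrable lborel (\<lambda>x. g x * \<eta> x)) \<and>
     T = (\<lambda>\<eta>\<in>schwartz. LINT x|lborel. g x * \<eta> x)"


section \<open>The spaces $H^{\alpha,p}$\<close>

definition Lp_norm :: "ennreal \<Rightarrow> ('a::euclidean_space \<Rightarrow> complex) \<Rightarrow> ennreal" where
  "Lp_norm p g =
    (if p = \<infinity> then esssup lborel (\<lambda>x. ennreal (norm (g x)))
     else let I = \<integral>\<^sup>+x. ennreal (norm (g x) powr enn2real p) \<partial>lborel
          in if I = \<infinity> then \<infinity> else ennreal (enn2real I powr (1 / enn2real p)))"

text \<open>Intended for \<open>1 \<le> p \<le> \<infinity>\<close>.\<close>

definition H_space ::
  "real \<Rightarrow> ennreal \<Rightarrow> (('a::euclidean_space \<Rightarrow> complex) \<Rightarrow> complex) set" where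
  "H_space \<alpha> p = {f \<in> tempered. \<exists>g. is_function_distr (fourier_distr f) g \<and>
      Lp_norm p (\<lambda>\<xi>. of_real ((1 + (norm \<xi>)\<^sup>2) powr (\<alpha> / 2)) * g \<xi>) < \<infinity>}"


section \<open>The finite-length V-line transform\<close>

definition vline_dir :: "real \<Rightarrow> real ^ 2" where
  "vline_dir \<theta> = vector [cos (\<theta> - pi / 2), sin (\<theta> - pi / 2)]"

definition ray_symbol :: "real \<Rightarrow> real \<Rightarrow> complex" where
  "ray_symbol \<nu> y = integral {0..\<nu>} (\<lambda>t. exp (\<i> * of_real (t * y)))"

definition vline_symbol :: "real \<Rightarrow> real \<Rightarrow> real \<Rightarrow> real \<Rightarrow> real \<Rightarrow> real ^ 2 \<Rightarrow> complex" where
  "vline_symbol a b \<psi> \<nu> \<phi> \<xi> =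
     of_real a * ray_symbol \<nu> (\<xi> \<bullet> vline_dir (\<phi> + 2 * \<psi>)) +
     of_real b * ray_symbol \<nu> (\<xi> \<bullet> vline_dir \<phi>)"

text \<open>For fixed \<open>\<phi>\<close>, the transform of a tempered distribution \<open>f\<close> is the tempered distribution whose
  Fourier transform is that of \<open>f\<close> multiplied by the symbol of
  \<open>f \<mapsto> a \<integral>\<^sub>0\<^sup>\<nu> f(x + t\<Phi>) dt + b \<integral>\<^sub>0\<^sup>\<nu> f(x + t\<Phi>') dt\<close>. The symbol is smooth with bounded derivatives, and
  the Fourier transform is a bijection of the tempered distributions, so exactly one \<open>u\<close> qualifies.
  When the Fourier transform of \<open>f\<close> is a function \<open>g\<close>, that of \<open>u\<close> is the pointwise product of \<open>g\<close>
  and the symbol.\<close>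

definition vline_transform :: "real \<Rightarrow> real \<Rightarrow> real \<Rightarrow> real \<Rightarrow>
    ((real ^ 2 \<Rightarrow> complex) \<Rightarrow> complex) \<Rightarrow> real \<Rightarrow> (real ^ 2 \<Rightarrow> complex) \<Rightarrow> complex" where
  "vline_transform a b \<psi> \<nu> f \<phi> =
     (SOME u. u \<in> tempered \<and>
        fourier_distr u = mult_distr (vline_symbol a b \<psi> \<nu> \<phi>) (fourier_distr f))"

end

theory Submission
  imports Defs "HOL-Probability.Characteristic_Functions"
begin

text \<open>The transform is realised without Fourier inversion: if \<open>A w \<eta> x = \<integral>\<^sub>0\<^sup>\<nu> \<eta>(x - t w) dt\<close>, then
  \<open>\<eta> \<mapsto> a f(A \<Phi> \<eta>) + b f(A \<Phi>' \<eta>)\<close> is the distribution sought, since \<open>A w\<close> commutes with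
  derivatives and therefore acts continuously on Schwartz functions, and by Fubini it corresponds under
  the Fourier transform to multiplication by the symbol \<open>m(\<xi> \<bullet> w)\<close>.

  The gain of regularity comes from \<open>\<bar>m(y)\<bar>\<^sup>2 \<le> (\<nu>\<^sup>2 + 4) / (1 + y\<^sup>2)\<close>: the symbol is square integrable
  across the ray, so in the plane the weight \<open>(1 + \<bar>\<xi>\<bar>\<^sup>2)\<close> to the power \<open>\<alpha> - \<beta>\<close> only has to be integrable
  in one remaining variable, which needs exactly \<open>\<beta> - \<alpha> > 1/2\<close>.\<close>

section \<open>Schwartz functions\<close>

text \<open>The definition of a Schwartz function speaks of all iterated derivatives, and for
  products, Fourier transforms and ray averages these have no convenient closed form. In each case a
  set of functions closed under partial derivatives is exhibited instead, and only the decay of its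
  members is estimated.

  The Fourier transform of a distribution is tested on transforms of test functions, so
  \<open>fourier\<close> has to be shown to preserve \<open>schwartz\<close>. The two halves of that
  proof mirror each other: smoothness of the transform comes from decay of the argument, decay of
  the transform from smoothness of the argument.

  \<open>vline_transform\<close> is a choice among the distributions with a prescribed Fourier
  transform. Once one exists, the chosen one satisfies the same equation, and membership in the
  target space is read off from that equation: the Fourier transform is the symbol times a function
  bounded almost everywhere by a multiple of (1 + \<bar>\<xi>\<bar>^2) to the power
  -\<beta>/2.\<close>

abbreviation partial_deriv ::
  "'a \<Rightarrow> ('a::euclidean_space \<Rightarrow> complex) \<Rightarrow> 'a \<Rightarrow> complex" where
  "partial_deriv v \<eta> \<equiv> (\<lambda>x. frechet_derivative \<eta> (at x) v)"

lemma iter_partial_append: "iter_partial (us @ vs) \<eta> = iter_partial us (iter_partial vs \<eta>)"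
  by (induction us) simp_all

lemma has_derivative_imp_partial_deriv:
  assumes "(\<eta> has_derivative D) (at x)"
  shows "partial_deriv v \<eta> x = D v"
  by (simp flip: frechet_derivative_at[OF assms])

text \<open>Only the partial derivatives along \<open>Basis\<close> are known to be Schwartz
  functions, so the full derivative is expressed through them before it is integrated along a
  ray.\<close>

lemma has_derivative_partial_deriv:
  fixes \<eta> :: "'a::euclidean_space \<Rightarrow> complex"
  assumes "\<eta> differentiable (at x)"
  shows "(\<eta> has_derivative (\<lambda>w. \<Sum>v\<in>Basis. (w \<bullet> v) *\<^sub>R partial_deriv v \<eta> x)) (at x)"
proof -
  have D: "(\<eta> has_derivative frechet_derivative \<eta> (at x)) (at x)"
    using assms frechet_derivative_works by blast
  interpret linear "frechet_derivative \<eta> (at x)"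
    using D has_derivative_linear by blast
  have "frechet_derivative \<eta> (at x) w = (\<Sum>v\<in>Basis. (w \<bullet> v) *\<^sub>R partial_deriv v \<eta> x)" for w
    by (subst (1) euclidean_representation[of w, symmetric]) (simp add: sum scaleR)
  then show ?thesis
    using D by (metis (no_types, lifting) ext)
qed

text \<open>A set closed under partial derivatives contains every \<open>iter_partial\<close> of its
  members, so decay has to be checked for the members only. It will be applied to sums of products
  and to the images of \<open>schwartz\<close> under \<open>fourier\<close> and under the ray
  averages.\<close>

lemma schwartz_coinduct [consumes 1, case_names differentiable bounded partial_deriv]:
  fixes A :: "('a::euclidean_space \<Rightarrow> complex) set"
  assumes "\<eta> \<in> A"
    and diff: "\<And>\<eta> x. \<eta> \<in> A \<Longrightarrow> \<eta> differentiable (at x)"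
    and bdd: "\<And>\<eta> k. \<eta> \<in> A \<Longrightarrow> \<exists>C. \<forall>x. (1 + norm x) ^ k * norm (\<eta> x) \<le> C"
    and part: "\<And>\<eta> v. \<eta> \<in> A \<Longrightarrow> v \<in> Basis \<Longrightarrow> partial_deriv v \<eta> \<in> A"
  shows "\<eta> \<in> schwartz"
proof -
  have A: "iter_partial vs \<eta> \<in> A" if "set vs \<subseteq> Basis" for vs
    using that \<open>\<eta> \<in> A\<close> part by (induction vs) auto
  show ?thesis
    unfolding schwartz_def
  proof (intro CollectI allI impI conjI)
    fix vs :: "'a list" and k :: nat
    assume vs: "set vs \<subseteq> Basis"
    show "iter_partial vs \<eta> differentiable_on UNIV"
      using diff[OF A[OF vs]] by (simp add: differentiable_on_def)
    obtain C where "\<forall>x. (1 + norm x) ^ k * norm (iter_partial vs \<eta> x) \<le> C"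
      using bdd[OF A[OF vs]] by blast
    then show "bounded (range (\<lambda>x. (1 + norm x) ^ k *\<^sub>R iter_partial vs \<eta> x))"
      by (auto simp: bounded_iff norm_mult norm_power intro!: exI[of _ C])
  qed
qed

lemma schwartz_differentiable: "\<eta> \<in> schwartz \<Longrightarrow> \<eta> differentiable (at x)"
  by (auto simp: schwartz_def differentiable_on_def dest!: spec[of _ "[]"])

lemma schwartz_iter_partial_bounded:
  assumes "\<eta> \<in> schwartz" "set vs \<subseteq> Basis"
  shows "bdd_above (range (\<lambda>x. (1 + norm x) ^ k * norm (iter_partial vs \<eta> x)))"
proof -
  have "bounded (range (\<lambda>x. (1 + norm x) ^ k *\<^sub>R iter_partial vs \<eta> x))"
    using assms by (auto simp: schwartz_def)
  then show ?thesis
    by (auto simp: bounded_iff norm_mult norm_power bdd_above_def)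
qed

lemma schwartz_bounded:
  assumes "\<eta> \<in> schwartz"
  obtains C where "C \<ge> 0" "\<And>x. (1 + norm x) ^ k * norm (\<eta> x) \<le> C"
proof -
  obtain C where C: "(1 + norm x) ^ k * norm (\<eta> x) \<le> C" for x
    using schwartz_iter_partial_bounded[OF assms, of "[]" k] by (auto simp: bdd_above_def)
  have "C \<ge> 0"
    using C[of 0] by (smt (verit) norm_ge_zero mult_nonneg_nonneg zero_le_power)
  then show ?thesis
    using C that by blast
qed

lemma schwartz_partial_deriv:
  assumes "\<eta> \<in> schwartz" "v \<in> Basis"
  shows "partial_deriv v \<eta> \<in> schwartz"
proof -
  \<comment> \<open>The head of the list is applied last, so the derivative taken first stands at
    the end.\<close>
  have "iter_partial us (partial_deriv v \<eta>) = iter_partial (us @ [v]) \<eta>" for us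
    by (simp add: iter_partial_append)
  with assms show ?thesis
    by (auto simp: schwartz_def simp del: iter_partial.simps)
qed

lemma schwartz_continuous: "\<eta> \<in> schwartz \<Longrightarrow> continuous_on A \<eta>"
  by (meson continuous_at_imp_continuous_on differentiable_imp_continuous_within schwartz_differentiable)

lemma schwartz_measurable: "\<eta> \<in> schwartz \<Longrightarrow> \<eta> \<in> borel_measurable borel"
  by (intro borel_measurable_continuous_onI schwartz_continuous)


text \<open>Products \<open>h * \<eta>\<close> are not closed under derivatives, but their sums are, by the product rule.\<close>

inductive_set leibniz_span ::
  "('a::euclidean_space \<Rightarrow> complex) set \<Rightarrow> ('a \<Rightarrow> complex) set" for M where
  prod: "h \<in> M \<Longrightarrow> \<eta> \<in> schwartz \<Longrightarrow> (\<lambda>x. h x * \<eta> x) \<in> leibniz_span M"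
| add: "\<eta> \<in> leibniz_span M \<Longrightarrow> \<zeta> \<in> leibniz_span M \<Longrightarrow> (\<lambda>x. \<eta> x + \<zeta> x) \<in> leibniz_span M"

text \<open>There are two instances: affine functions, which appear when a Fourier transform is
  differentiated, and the derivatives of the ray symbol.\<close>

locale multipliers =
  fixes M :: "('a::euclidean_space \<Rightarrow> complex) set"
  assumes differentiable: "h \<in> M \<Longrightarrow> h differentiable (at x)"
    and moderate: "h \<in> M \<Longrightarrow> \<exists>k C. \<forall>x. norm (h x) \<le> C * (1 + norm x) ^ k"
    and partial_deriv: "h \<in> M \<Longrightarrow> v \<in> Basis \<Longrightarrow> partial_deriv v h \<in> M"
begin

lemma leibniz_span_schwartz:
  assumes "\<eta> \<in> leibniz_span M"
  shows "\<eta> \<in> schwartz"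
  using assms
proof (rule schwartz_coinduct)
  fix \<eta> :: "'a \<Rightarrow> complex" and x k
  assume \<eta>: "\<eta> \<in> leibniz_span M"
  show diff: "\<eta> differentiable (at x)" for x
    using \<eta> by induction (auto intro: differentiable schwartz_differentiable differentiable_mult differentiable_add)
  show "\<exists>C. \<forall>x. (1 + norm x) ^ k * norm (\<eta> x) \<le> C"
    using \<eta>
  proof induction
    case (prod h \<eta>)
    obtain l B where B: "norm (h x) \<le> B * (1 + norm x) ^ l" for x
      using moderate[OF prod(1)] by blast
    have "B \<ge> 0"
      using order_trans[OF norm_ge_zero B[of 0]] by simp
    obtain C where C: "(1 + norm x) ^ (k + l) * norm (\<eta> x) \<le> C" for x
      using schwartz_bounded[OF prod(2)] by metis
    have "(1 + norm x) ^ k * norm (h x * \<eta> x) \<le> B * C" for x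
    proof -
      have "(1 + norm x) ^ k * norm (h x * \<eta> x)
          \<le> (1 + norm x) ^ k * (B * (1 + norm x) ^ l * norm (\<eta> x))"
        unfolding norm_mult by (intro mult_left_mono mult_right_mono B) auto
      also have "\<dots> = B * ((1 + norm x) ^ (k + l) * norm (\<eta> x))"
        by (simp add: power_add)
      also have "\<dots> \<le> B * C"
        using C \<open>B \<ge> 0\<close> by (rule mult_left_mono)
      finally show ?thesis .
    qed
    then show ?case by blast
  next
    case (add \<eta> \<zeta>)
    then obtain C D where
      CD: "(1 + norm x) ^ k * norm (\<eta> x) \<le> C" "(1 + norm x) ^ k * norm (\<zeta> x) \<le> D" for x
      by blast
    have "(1 + norm x) ^ k * norm (\<eta> x + \<zeta> x) \<le> C + D" for x
    proof -
      have "(1 + norm x) ^ k * norm (\<eta> x + \<zeta> x) \<le> (1 + norm x) ^ k * (norm (\<eta> x) + norm (\<zeta> x))"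
        by (intro mult_left_mono norm_triangle_ineq) auto
      then show ?thesis
        using CD[of x] by (simp add: distrib_left)
    qed
    then show ?case by blast
  qed
  show "partial_deriv v \<eta> \<in> leibniz_span M" if v: "v \<in> Basis" for v
    using \<eta>
  proof induction
    case (prod h \<eta>)
    have "partial_deriv v (\<lambda>x. h x * \<eta> x) x = h x * partial_deriv v \<eta> x + partial_deriv v h x * \<eta> x" for x
      using differentiable[OF prod(1), of x] schwartz_differentiable[OF prod(2), of x]
      by (intro has_derivative_imp_partial_deriv has_derivative_mult)
         (simp_all flip: frechet_derivative_works)
    moreover have "(\<lambda>x. h x * partial_deriv v \<eta> x + partial_deriv v h x * \<eta> x) \<in> leibniz_span M"
      by (intro leibniz_span.intros partial_deriv schwartz_partial_deriv prod v)
    ultimately show ?case by presburger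
  next
    case (add \<eta> \<zeta>)
    have diff: "\<eta> differentiable (at x)" if "\<eta> \<in> leibniz_span M" for \<eta> x
      using that by induction (auto intro: differentiable schwartz_differentiable differentiable_mult differentiable_add)
    have "partial_deriv v (\<lambda>x. \<eta> x + \<zeta> x) x = partial_deriv v \<eta> x + partial_deriv v \<zeta> x" for x
      using diff[OF add.hyps(1), of x] diff[OF add.hyps(2), of x]
      by (intro has_derivative_imp_partial_deriv has_derivative_add)
         (simp_all flip: frechet_derivative_works)
    then show ?case
      using leibniz_span.add[OF add.IH] by presburger
  qed
qed

lemma schwartz_mult: "h \<in> M \<Longrightarrow> \<eta> \<in> schwartz \<Longrightarrow> (\<lambda>x. h x * \<eta> x) \<in> schwartz"
  by (rule leibniz_span_schwartz[OF leibniz_span.prod])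

end

text \<open>Affine rather than linear, since the derivative of x \<bullet> w is a constant. Constant
  multiples (\<open>d = 0\<close>) and sums (both summands multiplied by 1) of Schwartz functions
  come out as special cases.\<close>

interpretation affine: multipliers "{\<lambda>x. c + d * of_real (x \<bullet> w) |c d w. True}"
proof
  fix h :: "'a \<Rightarrow> complex" and x
  assume "h \<in> {\<lambda>x. c + d * of_real (x \<bullet> w) |c d w. True}"
  then obtain c d w where h: "h = (\<lambda>x. c + d * of_real (x \<bullet> w))" by blast
  have D: "(h has_derivative (\<lambda>y. d * of_real (y \<bullet> w))) (at x)" for x
    unfolding h by (auto intro!: derivative_eq_intros)
  then show "h differentiable (at x)"
    using differentiable_def by blast
  have "norm (h x) \<le> (norm c + norm d * norm w) * (1 + norm x) ^ 1" for x
  proof -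
    have "norm (h x) \<le> norm c + norm d * (norm x * norm w)"
      unfolding h by (rule order_trans[OF norm_triangle_ineq])
        (auto simp: norm_mult intro!: mult_left_mono Cauchy_Schwarz_ineq2)
    also have "\<dots> \<le> (norm c + norm d * norm w) * (1 + norm x) ^ 1"
      by (simp add: algebra_simps)
    finally show ?thesis .
  qed
  then show "\<exists>k C. \<forall>x. norm (h x) \<le> C * (1 + norm x) ^ k" by blast
  fix v :: 'a
  have "partial_deriv v h = (\<lambda>x. d * of_real (v \<bullet> w) + 0 * of_real (x \<bullet> w))"
    using has_derivative_imp_partial_deriv[OF D] by fastforce
  then show "partial_deriv v h \<in> {\<lambda>x. c + d * of_real (x \<bullet> w) |c d w. True}" by blast
qed

lemma schwartz_mult_inner:
  assumes "\<eta> \<in> schwartz"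
  shows "(\<lambda>x. c * of_real (x \<bullet> w) * \<eta> x) \<in> schwartz"
proof -
  have "(\<lambda>x. (0 + c * of_real (x \<bullet> w)) * \<eta> x) \<in> schwartz"
    by (rule affine.schwartz_mult[OF _ assms]) blast
  then show ?thesis by simp
qed

lemma schwartz_cmult:
  assumes "\<eta> \<in> schwartz"
  shows "(\<lambda>x. c * \<eta> x) \<in> schwartz"
proof -
  have "(\<lambda>x. (c + 0 * of_real (x \<bullet> 0)) * \<eta> x) \<in> schwartz"
    by (rule affine.schwartz_mult[OF _ assms]) blast
  then show ?thesis by simp
qed

lemma schwartz_add:
  assumes "\<eta> \<in> schwartz" "\<zeta> \<in> schwartz"
  shows "(\<lambda>x. \<eta> x + \<zeta> x) \<in> schwartz"
proof -
  let ?M = "{\<lambda>x::'a. c + d * of_real (x \<bullet> w) |c d w. True}"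
  have 1: "(\<lambda>x. 1 + 0 * of_real (x \<bullet> 0)) \<in> ?M"
    by blast
  from leibniz_span.add[OF leibniz_span.prod[OF 1 assms(1)] leibniz_span.prod[OF 1 assms(2)]]
  have "(\<lambda>x. \<eta> x + \<zeta> x) \<in> leibniz_span ?M"
    by simp
  then show ?thesis
    by (rule affine.leibniz_span_schwartz)
qed


section \<open>Integrability\<close>

text \<open>On [-1, 1] the integrand is at most 1; outside it lies below \<bar>y\<bar> to the power
  -2\<gamma>, which is integrable at infinity because 2\<gamma> > 1. This is the source of the
  threshold 1/2 in the theorem.\<close>

lemma nn_integral_one_plus_square_powr_finite:
  fixes \<gamma> :: real
  assumes "\<gamma> > 1 / 2"
  shows "(\<integral>\<^sup>+y. ennreal ((1 + y\<^sup>2) powr (- \<gamma>)) \<partial>lborel) < \<infinity>"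
proof -
  define g where "g = (\<lambda>y::real. ennreal (indicator {1..} y * y powr (- 2 * \<gamma>)))"
  have [measurable]: "g \<in> borel_measurable borel"
    unfolding g_def by measurable
  have "((\<lambda>y::real. y powr (- 2 * \<gamma>)) has_integral - (1 powr (- 2 * \<gamma> + 1)) / (- 2 * \<gamma> + 1)) {1..}"
    using assms by (intro has_integral_powr_to_inf) auto
  from nn_integral_has_integral_lebesgue[OF _ this]
  have g: "(\<integral>\<^sup>+y. g y \<partial>lborel) < \<infinity>"
    by (simp add: g_def ennreal_mult' ennreal_indicator mult.commute)
  have g': "(\<integral>\<^sup>+y. g (- y) \<partial>lborel) < \<infinity>"
    using g nn_integral_real_affine[of g "-1" 0] by simp
  have "(\<integral>\<^sup>+y. ennreal ((1 + y\<^sup>2) powr (- \<gamma>)) \<partial>lborel)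
      \<le> (\<integral>\<^sup>+y. indicator {-1..1} y + g y + g (- y) \<partial>lborel)"
  proof (rule nn_integral_mono)
    fix y :: real
    \<comment> \<open>Stated for any \<open>z\<close> with the same square as \<open>y\<close>, so
      that z = y and z = -y serve the two tails.\<close>
    have tail: "(1 + y\<^sup>2) powr (- \<gamma>) \<le> z powr (- 2 * \<gamma>)" if "z \<ge> 1" "z\<^sup>2 = y\<^sup>2" for z
    proof -
      have "(1 + y\<^sup>2) powr (- \<gamma>) \<le> (z\<^sup>2) powr (- \<gamma>)"
        using assms that by (intro powr_mono2') (auto simp flip: that(2))
      also have "z\<^sup>2 = z powr 2"
        using that by simp
      finally show ?thesis
        by (simp add: powr_powr)
    qed
    consider "y \<in> {-1..1}" | "y \<ge> 1" | "- y \<ge> 1"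
      by fastforce
    then show "ennreal ((1 + y\<^sup>2) powr (- \<gamma>)) \<le> indicator {-1..1} y + g y + g (- y)"
    proof cases
      case 1
      have "(1 + y\<^sup>2) powr (- \<gamma>) \<le> 1 powr (- \<gamma>)"
        using assms by (intro powr_mono2') auto
      then have "ennreal ((1 + y\<^sup>2) powr (- \<gamma>)) \<le> 1"
        by (simp add: ennreal_le_1)
      then show ?thesis
        using 1 by (simp add: add_increasing2 add.assoc)
    next
      case 2
      then have "ennreal ((1 + y\<^sup>2) powr (- \<gamma>)) \<le> g y"
        using tail[of y] by (auto simp: g_def intro!: ennreal_leI)
      then show ?thesis
        by (simp add: add_increasing2 add_increasing)
    next
      case 3
      then have "ennreal ((1 + y\<^sup>2) powr (- \<gamma>)) \<le> g (- y)"
        using tail[of "- y"] by (auto simp: g_def intro!: ennreal_leI)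
      then show ?thesis
        by (simp add: add_increasing2 add_increasing)
    qed
  qed
  also have "\<dots> = (\<integral>\<^sup>+y. indicator {-1..1::real} y \<partial>lborel) + (\<integral>\<^sup>+y. g y \<partial>lborel) + (\<integral>\<^sup>+y. g (- y) \<partial>lborel)"
    by (subst nn_integral_add; (measurable)?)+
  also have "\<dots> < \<infinity>"
    using g g' by simp
  finally show ?thesis .
qed

text \<open>Each of the \<open>DIM('a)\<close> factors 1 + (x \<bullet> b)^2 is at most (1 +
  \<bar>x\<bar>)^2, whence the exponent. The function is thus dominated by a product of one-variable
  functions, whose integral factors over the coordinates.\<close>

lemma integrable_norm_inverse_power:
  "integrable lborel (\<lambda>x::'a::euclidean_space. 1 / (1 + norm x) ^ (2 * DIM('a)))"
proof (rule integrableI_bounded)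
  have "(\<integral>\<^sup>+(x::'a). ennreal (norm (1 / (1 + norm x) ^ (2 * DIM('a)))) \<partial>lborel)
      \<le> (\<integral>\<^sup>+(x::'a). (\<Prod>b\<in>Basis. ennreal ((1 + (x \<bullet> b)\<^sup>2) powr (- 1))) \<partial>lborel)"
  proof (rule nn_integral_mono)
    fix x :: 'a
    have "(1 + (x \<bullet> b)\<^sup>2) \<le> (1 + norm x)\<^sup>2" if "b \<in> Basis" for b
    proof -
      have "(x \<bullet> b)\<^sup>2 \<le> (norm x)\<^sup>2"
        using Basis_le_norm[OF that, of x] by (metis abs_ge_zero abs_norm_cancel power2_abs power_mono)
      then show ?thesis
        by (simp add: power2_sum add_increasing2)
    qed
    then have "(\<Prod>b\<in>(Basis::'a set). 1 + (x \<bullet> b)\<^sup>2) \<le> (\<Prod>b\<in>(Basis::'a set). (1 + norm x)\<^sup>2)"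
      by (intro prod_mono) auto
    also have "\<dots> = (1 + norm x) ^ (2 * DIM('a))"
      by (simp add: power_mult)
    finally have le: "(\<Prod>b\<in>(Basis::'a set). 1 + (x \<bullet> b)\<^sup>2) \<le> (1 + norm x) ^ (2 * DIM('a))" .
    have pos: "0 < (\<Prod>b\<in>(Basis::'a set). 1 + (x \<bullet> b)\<^sup>2)"
      by (intro prod_pos) (simp add: add_pos_nonneg)
    have "norm (1 / (1 + norm x) ^ (2 * DIM('a))) = inverse ((1 + norm x) ^ (2 * DIM('a)))"
      by (simp add: inverse_eq_divide)
    also have "\<dots> \<le> inverse (\<Prod>b\<in>(Basis::'a set). 1 + (x \<bullet> b)\<^sup>2)"
      using le pos by (rule le_imp_inverse_le)
    also have "\<dots> = (\<Prod>b\<in>(Basis::'a set). (1 + (x \<bullet> b)\<^sup>2) powr (- 1))"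
      by (simp add: prod_inversef[symmetric] o_def powr_minus add_pos_nonneg)
    finally show "ennreal (norm (1 / (1 + norm x) ^ (2 * DIM('a))))
        \<le> (\<Prod>b\<in>Basis. ennreal ((1 + (x \<bullet> b)\<^sup>2) powr (- 1)))"
      by (subst prod_ennreal) (auto intro: ennreal_leI)
  qed
  also have "\<dots> = (\<Prod>b\<in>(Basis::'a set). (\<integral>\<^sup>+y. ennreal ((1 + y\<^sup>2) powr (- 1)) \<partial>lborel))"
    by (rule nn_integral_lborel_prod) auto
  also have "\<dots> < \<infinity>"
    using nn_integral_one_plus_square_powr_finite[of 1] by (simp add: power_less_top_ennreal)
  finally show "(\<integral>\<^sup>+(x::'a). ennreal (norm (1 / (1 + norm x) ^ (2 * DIM('a)))) \<partial>lborel) < \<infinity>" .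
qed simp

lemma integrable_of_decay:
  fixes f :: "'a::euclidean_space \<Rightarrow> complex"
  assumes "f \<in> borel_measurable borel"
    and bound: "\<And>x. (1 + norm x) ^ (2 * DIM('a)) * norm (f x) \<le> C"
  shows "integrable lborel f"
proof (rule Bochner_Integration.integrable_bound)
  show "integrable lborel (\<lambda>x::'a. C * (1 / (1 + norm x) ^ (2 * DIM('a))))"
    by (intro integrable_mult_right integrable_norm_inverse_power)
  have "norm (f x) \<le> norm (C * (1 / (1 + norm x) ^ (2 * DIM('a))))" for x
  proof -
    have "(1 + norm x) ^ (2 * DIM('a)) > 0"
      by (simp add: add_pos_nonneg)
    then have "norm (f x) \<le> C / (1 + norm x) ^ (2 * DIM('a))"
      using bound[of x] by (simp add: pos_le_divide_eq mult.commute)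
    then show ?thesis
      by (metis mult.right_neutral order_trans abs_ge_self real_norm_def times_divide_eq_right)
  qed
  then show "AE x in lborel. norm (f x) \<le> norm (C * (1 / (1 + norm x) ^ (2 * DIM('a))))"
    by simp
qed (use assms in simp)

lemma schwartz_integrable: "(\<eta> :: 'a::euclidean_space \<Rightarrow> complex) \<in> schwartz \<Longrightarrow> integrable lborel \<eta>"
  by (rule schwartz_bounded[of \<eta> "2 * DIM('a)"])
    (blast intro: integrable_of_decay schwartz_measurable)+

lemma schwartz_integrable_mult_bounded:
  assumes "\<eta> \<in> schwartz" "h \<in> borel_measurable borel" "\<And>x. norm (h x) \<le> B"
  shows "integrable lborel (\<lambda>x. h x * \<eta> x)"
proof (rule Bochner_Integration.integrable_bound)
  show "integrable lborel (\<lambda>x. B * norm (\<eta> x))"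
    by (intro integrable_mult_right integrable_norm schwartz_integrable assms)
  show "AE x in lborel. norm (h x * \<eta> x) \<le> norm (B * norm (\<eta> x))"
    using assms(3) by (auto simp: norm_mult intro!: mult_right_mono order_trans[OF _ abs_ge_self])
next
  have [measurable]: "h \<in> borel_measurable borel" "\<eta> \<in> borel_measurable borel"
    using assms schwartz_measurable by auto
  show "(\<lambda>x. h x * \<eta> x) \<in> borel_measurable lborel" by measurable
qed


section \<open>The Fourier transform of Schwartz functions\<close>

text \<open>An inequality of Peetre type: it carries a polynomial weight through a translation by
  \<open>y\<close> at a cost that depends on \<open>y\<close> alone.\<close>

lemma one_plus_norm_le: "1 + norm x \<le> (1 + norm y) * (1 + norm (x + y))"
  for x y :: "'a::real_normed_vector"
proof -
  have "norm x \<le> norm (x + y) + norm y"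
    using norm_triangle_ineq4[of "x + y" y] by simp
  also have "1 + (norm (x + y) + norm y) \<le> (1 + norm y) * (1 + norm (x + y))"
    by (simp add: algebra_simps)
  finally show ?thesis by simp
qed

text \<open>By translation invariance the difference quotients of \<open>G\<close> in direction \<open>v\<close> have integral
  \<open>0\<close>, and they converge dominatedly to the derivative.\<close>

lemma integral_partial_deriv_eq_0:
  fixes G :: "'a::euclidean_space \<Rightarrow> complex"
  assumes diff: "\<And>x. G differentiable (at x)"
    and int: "integrable lborel G"
    and bound: "\<And>x. (1 + norm x) ^ (2 * DIM('a)) * norm (partial_deriv v G x) \<le> C"
  shows "(LINT x|lborel. partial_deriv v G x) = 0"
proof -
  define t where "t = (\<lambda>n. 1 / real (Suc n))"
  define s where "s = (\<lambda>n x. (1 / t n) *\<^sub>R (G (x + t n *\<^sub>R v) - G x))"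
  have t: "0 < t n" "t n \<le> 1" for n
    by (auto simp: t_def)
  \<comment> \<open>At r = 0 this yields the limit of the difference quotients, at the other
    \<open>r\<close> the mean value bound that dominates them.\<close>
  have D: "((\<lambda>r. G (x + r *\<^sub>R v)) has_derivative (\<lambda>h. h *\<^sub>R partial_deriv v G (x + r *\<^sub>R v))) (at r)" for x r
  proof -
    have "(G has_derivative frechet_derivative G (at (x + r *\<^sub>R v))) (at (x + r *\<^sub>R v))"
      using diff frechet_derivative_works by blast
    then have *: "((\<lambda>r. G (x + r *\<^sub>R v)) has_derivative
        (\<lambda>h. frechet_derivative G (at (x + r *\<^sub>R v)) (h *\<^sub>R v))) (at r)"
      by (rule has_derivative_compose[rotated]) (auto intro!: derivative_eq_intros)
    have "linear (frechet_derivative G (at (x + r *\<^sub>R v)))"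
      using diff linear_frechet_derivative by blast
    then show ?thesis
      using * by (simp add: linear_cmul)
  qed
  have lim: "(\<lambda>n. s n x) \<longlonglongrightarrow> partial_deriv v G x" for x
  proof -
    have "(\<lambda>h. norm (G (x + h *\<^sub>R v) - G x - h *\<^sub>R partial_deriv v G x) / norm h) \<midarrow>0\<rightarrow> 0"
      using D[of x 0] by (simp add: has_derivative_at)
    moreover have "filterlim t (at 0) sequentially"
      using t(1) unfolding t_def filterlim_at
      by (auto simp: LIMSEQ_inverse_real_of_nat[unfolded inverse_eq_divide] less_imp_neq[symmetric] simp del: of_nat_Suc)
    ultimately have "(\<lambda>n. norm (G (x + t n *\<^sub>R v) - G x - t n *\<^sub>R partial_deriv v G x) / norm (t n)) \<longlonglongrightarrow> 0"
      by (rule filterlim_compose)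
    moreover have "norm (G (x + t n *\<^sub>R v) - G x - t n *\<^sub>R partial_deriv v G x) / norm (t n)
        = norm (s n x - partial_deriv v G x)" for n
    proof -
      have "s n x - partial_deriv v G x
          = (1 / t n) *\<^sub>R (G (x + t n *\<^sub>R v) - G x - t n *\<^sub>R partial_deriv v G x)"
        using t(1)[of n] by (simp add: s_def scaleR_diff_right)
      then show ?thesis
        by simp
    qed
    ultimately have "(\<lambda>n. norm (s n x - partial_deriv v G x)) \<longlonglongrightarrow> 0"
      by (simp only:)
    then show ?thesis
      by (rule LIM_zero_cancel[OF tendsto_norm_zero_cancel])
  qed
  have cont: "continuous_on UNIV G"
    by (meson continuous_at_imp_continuous_on diff differentiable_imp_continuous_within)
  then have [measurable]: "G \<in> borel_measurable borel"
    by (rule borel_measurable_continuous_onI)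
  have [measurable]: "s n \<in> borel_measurable borel" for n
    unfolding s_def by measurable
  let ?K = "2 * DIM('a)"
  have "(\<lambda>n. LINT x|lborel. s n x) \<longlonglongrightarrow> (LINT x|lborel. partial_deriv v G x)"
  proof (rule integral_dominated_convergence)
    show "integrable lborel (\<lambda>x::'a. ((1 + norm v) ^ ?K * C) * (1 / (1 + norm x) ^ ?K))"
      by (intro integrable_mult_right integrable_norm_inverse_power)
    show "AE x in lborel. norm (s n x) \<le> ((1 + norm v) ^ ?K * C) * (1 / (1 + norm x) ^ ?K)" for n
    proof (rule AE_I2)
      fix x
      \<comment> \<open>The mean value theorem replaces the quotient by the derivative at a point
        shifted by at most \<open>norm v\<close>, as \<open>t n \<le> 1\<close>. Moving the weight
        back to \<open>x\<close> then costs a factor independent of \<open>n\<close>.\<close>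
      have "\<exists>r\<in>{0<..<t n}. norm (G (x + t n *\<^sub>R v) - G (x + 0 *\<^sub>R v))
          \<le> norm ((t n - 0) *\<^sub>R partial_deriv v G (x + r *\<^sub>R v))"
        by (rule mvt_general[OF t(1) _ D])
          (auto intro!: continuous_intros continuous_on_compose2[OF cont])
      then obtain r where r: "0 < r" "r < t n"
        and le: "norm (G (x + t n *\<^sub>R v) - G x) \<le> t n * norm (partial_deriv v G (x + r *\<^sub>R v))"
        using t(1)[of n] by auto
      have "norm (s n x) \<le> norm (partial_deriv v G (x + r *\<^sub>R v))"
        using le t(1)[of n] by (simp add: s_def divide_le_eq mult.commute)
      moreover have "(1 + norm x) ^ ?K * norm (partial_deriv v G (x + r *\<^sub>R v)) \<le> (1 + norm v) ^ ?K * C"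
      proof -
        have "norm (r *\<^sub>R v) \<le> norm v"
          using r t(2)[of n] by (simp add: mult_left_le_one_le)
        then have "1 + norm x \<le> (1 + norm v) * (1 + norm (x + r *\<^sub>R v))"
          by (intro order_trans[OF one_plus_norm_le[of x "r *\<^sub>R v"]] mult_right_mono) auto
        then have "(1 + norm x) ^ ?K \<le> ((1 + norm v) * (1 + norm (x + r *\<^sub>R v))) ^ ?K"
          by (rule power_mono) auto
        then have "(1 + norm x) ^ ?K * norm (partial_deriv v G (x + r *\<^sub>R v))
            \<le> ((1 + norm v) * (1 + norm (x + r *\<^sub>R v))) ^ ?K * norm (partial_deriv v G (x + r *\<^sub>R v))"
          by (rule mult_right_mono) auto
        also have "\<dots> \<le> (1 + norm v) ^ ?K * C"
          unfolding power_mult_distrib mult.assoc by (intro mult_left_mono bound) auto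
        finally show ?thesis .
      qed
      then have "norm (partial_deriv v G (x + r *\<^sub>R v)) \<le> (1 + norm v) ^ ?K * C / (1 + norm x) ^ ?K"
        by (subst pos_le_divide_eq) (auto simp: add_pos_nonneg mult.commute)
      ultimately show "norm (s n x) \<le> ((1 + norm v) ^ ?K * C) * (1 / (1 + norm x) ^ ?K)"
        by simp
    qed
    \<comment> \<open>The derivative is not assumed continuous; it is measurable as a pointwise
      limit of the quotients.\<close>
    show "partial_deriv v G \<in> borel_measurable lborel"
      by (rule borel_measurable_LIMSEQ_metric[where f = s]) (use lim in auto)
  qed (use lim in auto)
  moreover have "(LINT x|lborel. s n x) = 0" for n
  proof -
    have "(LINT x|lborel. G (x + t n *\<^sub>R v)) = (LINT x|distr lborel borel ((+) (t n *\<^sub>R v)). G x)"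
      by (subst integral_distr) (auto simp: add.commute)
    moreover have "integrable (distr lborel borel ((+) (t n *\<^sub>R v))) G"
      using int by (simp add: lborel_distr_plus)
    then have "integrable lborel (\<lambda>x. G (x + t n *\<^sub>R v))"
      by (subst (asm) integrable_distr_eq) (auto simp: add.commute)
    ultimately show ?thesis
      using int by (simp add: s_def lborel_distr_plus)
  qed
  ultimately show ?thesis
    by (simp add: LIMSEQ_const_iff)
qed

section \<open>Derivatives and decay of the Fourier transform\<close>

lemma norm_exp_minus_i_times: "norm (exp (- (\<i> * of_real y))) = 1"
  by (simp add: norm_exp_eq_Re)

lemma integrable_fourier:
  "\<eta> \<in> schwartz \<Longrightarrow> integrable lborel (\<lambda>x. exp (- (\<i> * of_real (x \<bullet> \<xi>))) * \<eta> x)"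
  by (rule schwartz_integrable_mult_bounded[where B = 1]) (auto simp: norm_exp_minus_i_times)

lemma fourier_add:
  "\<eta> \<in> schwartz \<Longrightarrow> \<zeta> \<in> schwartz \<Longrightarrow> fourier (\<lambda>x. \<eta> x + \<zeta> x) = (\<lambda>\<xi>. fourier \<eta> \<xi> + fourier \<zeta> \<xi>)"
  by (auto simp: fourier_def distrib_left integrable_fourier)

lemma fourier_cmult: "fourier (\<lambda>x. c * \<eta> x) = (\<lambda>\<xi>. c * fourier \<eta> \<xi>)"
  by (simp add: fun_eq_iff fourier_def mult.left_commute)

text \<open>The Taylor remainder bound \<bar>exp(-iy) - 1 + iy\<bar> \<le> y^2/2 with y = x
  \<bullet> h makes the error quadratic in \<open>h\<close>, uniformly in its direction; the
  constant is half the second absolute moment of \<eta>.\<close>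

lemma has_derivative_fourier:
  fixes \<eta> :: "'a::euclidean_space \<Rightarrow> complex"
  assumes \<eta>: "\<eta> \<in> schwartz"
  shows "(fourier \<eta> has_derivative (\<lambda>w. fourier (\<lambda>x. - \<i> * of_real (x \<bullet> w) * \<eta> x) \<xi>)) (at \<xi>)"
    (is "(_ has_derivative ?D) _")
proof -
  let ?e = "\<lambda>x. exp (- (\<i> * of_real (x \<bullet> \<xi>)))"
  have inner_schwartz: "(\<lambda>x. - \<i> * of_real (x \<bullet> w) * \<eta> x) \<in> schwartz" for w
    by (rule schwartz_mult_inner[OF \<eta>])
  have "linear ?D"
  proof
    fix w w' :: 'a and r :: real
    have "(\<lambda>x. - \<i> * of_real (x \<bullet> (w + w')) * \<eta> x)
        = (\<lambda>x. - \<i> * of_real (x \<bullet> w) * \<eta> x + - \<i> * of_real (x \<bullet> w') * \<eta> x)"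
      by (simp add: fun_eq_iff inner_add_right algebra_simps)
    then show "?D (w + w') = ?D w + ?D w'"
      by (simp only: fourier_add[OF inner_schwartz inner_schwartz])
    have "(\<lambda>x. - \<i> * of_real (x \<bullet> (r *\<^sub>R w)) * \<eta> x) = (\<lambda>x. of_real r * (- \<i> * of_real (x \<bullet> w) * \<eta> x))"
      by (simp add: fun_eq_iff algebra_simps)
    then show "?D (r *\<^sub>R w) = r *\<^sub>R ?D w"
      by (simp only: fourier_cmult scaleR_conv_of_real)
  qed
  define C where "C = (LINT x|lborel. (norm x)\<^sup>2 * norm (\<eta> x))"
  \<comment> \<open>Two powers beyond those used for integrability absorb the factor \<bar>x\<bar>^2
    of the remainder.\<close>
  obtain B where B: "(1 + norm x) ^ (2 * DIM('a) + 2) * norm (\<eta> x) \<le> B" for x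
    using schwartz_bounded[OF \<eta>] by metis
  have int: "integrable lborel (\<lambda>x. (norm x)\<^sup>2 * norm (\<eta> x))"
  proof -
    have [measurable]: "\<eta> \<in> borel_measurable borel"
      using \<eta> by (rule schwartz_measurable)
    have "integrable lborel (\<lambda>x. of_real ((norm x)\<^sup>2) * \<eta> x)"
    proof (rule integrable_of_decay)
      fix x :: 'a
      have "(1 + norm x) ^ (2 * DIM('a)) * ((norm x)\<^sup>2 * norm (\<eta> x))
          \<le> (1 + norm x) ^ (2 * DIM('a)) * ((1 + norm x)\<^sup>2 * norm (\<eta> x))"
        by (intro mult_left_mono mult_right_mono power_mono) auto
      also have "\<dots> = (1 + norm x) ^ (2 * DIM('a) + 2) * norm (\<eta> x)"
        by (simp only: power_add mult.assoc)
      also note B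
      finally show "(1 + norm x) ^ (2 * DIM('a)) * norm (of_real ((norm x)\<^sup>2) * \<eta> x) \<le> B"
        by (simp add: norm_mult norm_power)
    qed measurable
    then show ?thesis
      by (drule_tac integrable_norm) (simp add: norm_mult norm_power)
  qed
  have approx: "norm (fourier \<eta> (\<xi> + h) - fourier \<eta> \<xi> - ?D h) \<le> C / 2 * (norm h)\<^sup>2" for h
  proof -
    let ?R = "\<lambda>x. ?e x * (exp (- (\<i> * of_real (x \<bullet> h))) - 1 + \<i> * of_real (x \<bullet> h)) * \<eta> x"
    let ?Q = "\<lambda>x. exp (- (\<i> * of_real (x \<bullet> (\<xi> + h)))) * \<eta> x - ?e x * \<eta> x
             - ?e x * (- \<i> * of_real (x \<bullet> h) * \<eta> x)"
    have Q: "?Q = ?R"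
    proof
      fix x
      have "exp (- (\<i> * of_real (x \<bullet> (\<xi> + h)))) = ?e x * exp (- (\<i> * of_real (x \<bullet> h)))"
        by (simp add: inner_add_right distrib_left flip: exp_add)
      then show "?Q x = ?R x"
        by (simp add: algebra_simps)
    qed
    have int_diff: "integrable lborel (\<lambda>x. exp (- (\<i> * of_real (x \<bullet> (\<xi> + h)))) * \<eta> x - ?e x * \<eta> x)"
      by (intro Bochner_Integration.integrable_diff integrable_fourier \<eta>)
    have "fourier \<eta> (\<xi> + h) - fourier \<eta> \<xi> - ?D h = (LINT x|lborel. ?Q x)"
      unfolding fourier_def Bochner_Integration.integral_diff[OF int_diff integrable_fourier[OF inner_schwartz]]
        Bochner_Integration.integral_diff[OF integrable_fourier[OF \<eta>] integrable_fourier[OF \<eta>]] ..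
    also have "\<dots> = (LINT x|lborel. ?R x)"
      unfolding Q ..
    also have "norm \<dots> \<le> (LINT x|lborel. (norm h)\<^sup>2 / 2 * ((norm x)\<^sup>2 * norm (\<eta> x)))"
    proof (rule Bochner_Integration.integral_norm_bound_integral)
      fix x
      have "norm (exp (- (\<i> * of_real (x \<bullet> h))) - 1 + \<i> * of_real (x \<bullet> h)) \<le> (x \<bullet> h)\<^sup>2 / 2"
        using iexp_approx1[of "- (x \<bullet> h)" 1] by (simp add: algebra_simps power2_eq_square)
      also have "\<dots> \<le> (norm x * norm h)\<^sup>2 / 2"
        using power_mono[OF Cauchy_Schwarz_ineq2[of x h] abs_ge_zero, of 2] by simp
      finally show "norm (?R x) \<le> (norm h)\<^sup>2 / 2 * ((norm x)\<^sup>2 * norm (\<eta> x))"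
        by (auto simp: norm_mult norm_exp_minus_i_times power_mult_distrib ac_simps
            dest: mult_right_mono[OF _ norm_ge_zero[of "\<eta> x"]])
    next
      show "integrable lborel ?R"
        unfolding Q[symmetric]
        by (intro Bochner_Integration.integrable_diff int_diff integrable_fourier inner_schwartz)
    qed (use int in auto)
    also have "\<dots> = C / 2 * (norm h)\<^sup>2"
      by (simp add: C_def)
    finally show ?thesis .
  qed
  have "(\<lambda>h. norm (fourier \<eta> (\<xi> + h) - fourier \<eta> \<xi> - ?D h) / norm h) \<midarrow>0\<rightarrow> 0"
  proof (rule Lim_null_comparison)
    show "\<forall>\<^sub>F h in at 0. norm (norm (fourier \<eta> (\<xi> + h) - fourier \<eta> \<xi> - ?D h) / norm h) \<le> C / 2 * norm h"
      using approx by (auto simp: eventually_at_filter divide_le_eq power2_eq_square mult.assoc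
          intro!: always_eventually)
    show "((\<lambda>h::'a. C / 2 * norm h) \<longlongrightarrow> 0) (at 0)"
      by (auto intro!: tendsto_eq_intros)
  qed
  with \<open>linear ?D\<close> show ?thesis
    by (simp add: has_derivative_at linear_conv_bounded_linear)
qed

lemma partial_deriv_fourier:
  "\<eta> \<in> schwartz \<Longrightarrow> partial_deriv v (fourier \<eta>) = fourier (\<lambda>x. - \<i> * of_real (x \<bullet> v) * \<eta> x)"
  using has_derivative_imp_partial_deriv[OF has_derivative_fourier] by blast

text \<open>Integration by parts: the product of the character with \<eta> has a derivative of
  integral 0, and the product rule splits that derivative into the two sides of the
  identity.\<close>

lemma fourier_partial_deriv:
  fixes \<eta> :: "'a::euclidean_space \<Rightarrow> complex"
  assumes \<eta>: "\<eta> \<in> schwartz" and v: "v \<in> Basis"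
  shows "fourier (partial_deriv v \<eta>) \<xi> = \<i> * of_real (\<xi> \<bullet> v) * fourier \<eta> \<xi>"
proof -
  let ?e = "\<lambda>x. exp (- (\<i> * of_real (x \<bullet> \<xi>)))"
  have D: "((\<lambda>x. ?e x * \<eta> x) has_derivative
      (\<lambda>w. ?e x * frechet_derivative \<eta> (at x) w + (?e x * - (\<i> * of_real (w \<bullet> \<xi>))) * \<eta> x)) (at x)" for x
  proof (rule has_derivative_mult)
    show "(?e has_derivative (\<lambda>w. ?e x * - (\<i> * of_real (w \<bullet> \<xi>)))) (at x)"
      by (rule has_derivative_compose[OF _ DERIV_exp[unfolded has_field_derivative_def]])
        (auto intro!: derivative_eq_intros)
    show "(\<eta> has_derivative frechet_derivative \<eta> (at x)) (at x)"
      using schwartz_differentiable[OF \<eta>] frechet_derivative_works by blast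
  qed
  have part: "partial_deriv v (\<lambda>x. ?e x * \<eta> x) x
      = ?e x * partial_deriv v \<eta> x + - \<i> * of_real (\<xi> \<bullet> v) * (?e x * \<eta> x)" for x
    unfolding has_derivative_imp_partial_deriv[OF D] by (simp add: algebra_simps inner_commute)
  obtain B where B: "(1 + norm x) ^ (2 * DIM('a)) * norm (\<eta> x) \<le> B" for x
    using schwartz_bounded[OF \<eta>] by metis
  obtain B' where B': "(1 + norm x) ^ (2 * DIM('a)) * norm (partial_deriv v \<eta> x) \<le> B'" for x
    using schwartz_bounded[OF schwartz_partial_deriv[OF \<eta> v]] by metis
  have "(LINT x|lborel. partial_deriv v (\<lambda>x. ?e x * \<eta> x) x) = 0"
  proof (rule integral_partial_deriv_eq_0)
    show "(\<lambda>x. ?e x * \<eta> x) differentiable at x" for x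
      using D differentiable_def by blast
    show "integrable lborel (\<lambda>x. ?e x * \<eta> x)"
      by (rule integrable_fourier[OF \<eta>])
    fix x
    have "norm (partial_deriv v (\<lambda>x. ?e x * \<eta> x) x) \<le> norm (partial_deriv v \<eta> x) + \<bar>\<xi> \<bullet> v\<bar> * norm (\<eta> x)"
      unfolding part by (rule order_trans[OF norm_triangle_ineq]) (simp add: norm_mult norm_exp_minus_i_times)
    then have "(1 + norm x) ^ (2 * DIM('a)) * norm (partial_deriv v (\<lambda>x. ?e x * \<eta> x) x)
        \<le> (1 + norm x) ^ (2 * DIM('a)) * (norm (partial_deriv v \<eta> x) + \<bar>\<xi> \<bullet> v\<bar> * norm (\<eta> x))"
      by (rule mult_left_mono) auto
    also have "\<dots> = (1 + norm x) ^ (2 * DIM('a)) * norm (partial_deriv v \<eta> x)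
        + \<bar>\<xi> \<bullet> v\<bar> * ((1 + norm x) ^ (2 * DIM('a)) * norm (\<eta> x))"
      by (simp add: algebra_simps)
    also have "\<dots> \<le> B' + \<bar>\<xi> \<bullet> v\<bar> * B"
      by (intro add_mono mult_left_mono B B') auto
    finally show "(1 + norm x) ^ (2 * DIM('a)) * norm (partial_deriv v (\<lambda>x. ?e x * \<eta> x) x) \<le> B' + \<bar>\<xi> \<bullet> v\<bar> * B" .
  qed
  also have "(LINT x|lborel. partial_deriv v (\<lambda>x. ?e x * \<eta> x) x)
      = fourier (partial_deriv v \<eta>) \<xi> + - \<i> * of_real (\<xi> \<bullet> v) * fourier \<eta> \<xi>"
    unfolding part fourier_def
    by (subst Bochner_Integration.integral_add)
      (auto intro!: integrable_fourier \<eta> schwartz_partial_deriv[OF \<eta> v])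
  finally show ?thesis by simp
qed

lemma norm_fourier_le: "norm (fourier \<eta> \<xi>) \<le> (LINT x|lborel. norm (\<eta> x))"
proof -
  have "norm (fourier \<eta> \<xi>) \<le> (LINT x|lborel. norm (exp (- (\<i> * of_real (x \<bullet> \<xi>))) * \<eta> x))"
    unfolding fourier_def by (rule integral_norm_bound)
  then show ?thesis
    by (simp add: norm_mult norm_exp_minus_i_times)
qed

text \<open>One more power of the weight costs one derivative: 1 + \<bar>\<xi>\<bar> is at most 1
  plus the sum of the \<bar>\<xi> \<bullet> v\<bar>, and \<xi> \<bullet> v is absorbed by passing
  from \<eta> to its derivative along \<open>v\<close>. The induction therefore runs over all
  Schwartz functions simultaneously.\<close>

lemma fourier_decay:
  fixes \<eta> :: "'a::euclidean_space \<Rightarrow> complex"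
  assumes "\<eta> \<in> schwartz"
  shows "\<exists>C. \<forall>\<xi>. (1 + norm \<xi>) ^ k * norm (fourier \<eta> \<xi>) \<le> C"
  using assms
proof (induction k arbitrary: \<eta>)
  case 0
  then show ?case
    using norm_fourier_le by auto
next
  case (Suc k)
  obtain C where C: "(1 + norm \<xi>) ^ k * norm (fourier \<eta> \<xi>) \<le> C" for \<xi>
    using Suc by blast
  have "\<forall>v\<in>Basis. \<exists>D. \<forall>\<xi>. (1 + norm \<xi>) ^ k * norm (fourier (partial_deriv v \<eta>) \<xi>) \<le> D"
    using Suc.IH schwartz_partial_deriv[OF Suc.prems] by blast
  then obtain D where
    D: "(1 + norm \<xi>) ^ k * norm (fourier (partial_deriv v \<eta>) \<xi>) \<le> D v" if "v \<in> Basis" for v \<xi>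
    by metis
  have "(1 + norm \<xi>) ^ Suc k * norm (fourier \<eta> \<xi>) \<le> C + (\<Sum>v\<in>Basis. D v)" for \<xi>
  proof -
    have "(1 + norm \<xi>) ^ Suc k * norm (fourier \<eta> \<xi>)
        \<le> (1 + (\<Sum>v\<in>Basis. \<bar>\<xi> \<bullet> v\<bar>)) * ((1 + norm \<xi>) ^ k * norm (fourier \<eta> \<xi>))"
      unfolding power_Suc mult.assoc by (intro mult_right_mono add_left_mono norm_le_l1) auto
    also have "\<dots> = (1 + norm \<xi>) ^ k * norm (fourier \<eta> \<xi>)
        + (\<Sum>v\<in>Basis. \<bar>\<xi> \<bullet> v\<bar> * ((1 + norm \<xi>) ^ k * norm (fourier \<eta> \<xi>)))"
      by (simp only: distrib_right sum_distrib_right mult_1)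
    also have "\<dots> = (1 + norm \<xi>) ^ k * norm (fourier \<eta> \<xi>)
        + (\<Sum>v\<in>Basis. (1 + norm \<xi>) ^ k * norm (fourier (partial_deriv v \<eta>) \<xi>))"
      using Suc.prems by (simp add: fourier_partial_deriv norm_mult mult_ac)
    also have "\<dots> \<le> C + (\<Sum>v\<in>Basis. D v)"
      by (intro add_mono sum_mono C D)
    finally show ?thesis .
  qed
  then show ?case by blast
qed

lemma fourier_schwartz:
  assumes "\<eta> \<in> schwartz"
  shows "fourier \<eta> \<in> schwartz"
proof -
  have "fourier \<eta> \<in> fourier ` schwartz"
    using assms by blast
  then show ?thesis
  proof (rule schwartz_coinduct)
    fix \<zeta> :: "'a \<Rightarrow> complex" and x k v
    assume "\<zeta> \<in> fourier ` schwartz"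
    then obtain \<eta> where \<eta>: "\<eta> \<in> schwartz" "\<zeta> = fourier \<eta>" by blast
    show "\<zeta> differentiable (at x)"
      using has_derivative_fourier \<eta> differentiable_def by blast
    show "\<exists>C. \<forall>x. (1 + norm x) ^ k * norm (\<zeta> x) \<le> C"
      using fourier_decay \<eta> by blast
    show "partial_deriv v \<zeta> \<in> fourier ` schwartz"
      unfolding \<eta> partial_deriv_fourier[OF \<eta>(1)] by (intro imageI schwartz_mult_inner \<eta>)
  qed
qed


section \<open>Averages along rays\<close>

text \<open>The operator \<open>A w\<close> of the overview. The minus sign is that of a transpose:
  the integral of f(x + t w) \<eta>(x) over x equals that of f(x) \<eta>(x - t w).\<close>

definition ray_average :: "real \<Rightarrow> 'a \<Rightarrow> ('a::euclidean_space \<Rightarrow> complex) \<Rightarrow> 'a \<Rightarrow> complex" where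
  "ray_average \<nu> w \<eta> x = integral {0..\<nu>} (\<lambda>t. \<eta> (x - t *\<^sub>R w))"

lemma schwartz_continuous_compose:
  "\<eta> \<in> schwartz \<Longrightarrow> continuous_on A g \<Longrightarrow> continuous_on A (\<lambda>x. \<eta> (g x))"
  by (rule continuous_on_compose2[OF schwartz_continuous[of \<eta> UNIV]]) auto

lemma integrable_on_ray:
  assumes "\<eta> \<in> schwartz"
  shows "(\<lambda>t. \<eta> (x - t *\<^sub>R w)) integrable_on {0..\<nu>}"
  by (intro integrable_continuous_interval schwartz_continuous_compose[OF assms] continuous_intros)

lemma ray_average_add:
  "\<eta> \<in> schwartz \<Longrightarrow> \<zeta> \<in> schwartz \<Longrightarrow>
    ray_average \<nu> w (\<lambda>x. \<eta> x + \<zeta> x) = (\<lambda>x. ray_average \<nu> w \<eta> x + ray_average \<nu> w \<zeta> x)"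
  by (auto simp: ray_average_def fun_eq_iff intro!: integral_add integrable_on_ray)

lemma ray_average_cmult: "ray_average \<nu> w (\<lambda>x. c * \<eta> x) = (\<lambda>x. c * ray_average \<nu> w \<eta> x)"
  by (simp add: ray_average_def fun_eq_iff)

text \<open>Differentiating under the integral sign asks for a continuous family of bounded linear
  maps. \<open>D x t\<close> is assembled from the partial derivatives, whose continuity is known,
  and its integral is evaluated at \<open>h\<close> afterwards.\<close>

lemma has_derivative_ray_average:
  fixes \<eta> :: "'a::euclidean_space \<Rightarrow> complex"
  assumes \<eta>: "\<eta> \<in> schwartz"
  shows "(ray_average \<nu> w \<eta> has_derivative
    (\<lambda>h. \<Sum>v\<in>Basis. (h \<bullet> v) *\<^sub>R ray_average \<nu> w (partial_deriv v \<eta>) x)) (at x)"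
proof -
  define D where "D = (\<lambda>x t. \<Sum>v\<in>Basis.
    blinfun_scaleR_left (partial_deriv v \<eta> (x - t *\<^sub>R w)) o\<^sub>L blinfun_inner_right v)"
  have apply_D: "blinfun_apply (D x t) h = (\<Sum>v\<in>Basis. (h \<bullet> v) *\<^sub>R partial_deriv v \<eta> (x - t *\<^sub>R w))" for x t h
    by (simp add: D_def blinfun.sum_left inner_commute)
  have cont: "continuous_on A (\<lambda>p. D (fst p) (snd p))" for A
  proof (rule continuous_on_blinfun_componentwise)
    fix i :: 'a
    show "continuous_on A (\<lambda>p. blinfun_apply (D (fst p) (snd p)) i)"
      unfolding apply_D
      by (rule continuous_on_sum) (intro continuous_on_scaleR continuous_on_const
          schwartz_continuous_compose[OF schwartz_partial_deriv[OF \<eta>]] continuous_intros)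
  qed
  have "((\<lambda>x. integral (cbox 0 \<nu>) (\<lambda>t. \<eta> (x - t *\<^sub>R w))) has_derivative
      blinfun_apply (integral (cbox 0 \<nu>) (D x))) (at x within UNIV)"
  proof (rule leibniz_rule)
    show "((\<lambda>x. \<eta> (x - t *\<^sub>R w)) has_derivative blinfun_apply (D x t)) (at x)" for x t
    proof -
      have "((\<lambda>x. \<eta> (x - t *\<^sub>R w)) has_derivative
          (\<lambda>h. \<Sum>v\<in>Basis. (h \<bullet> v) *\<^sub>R partial_deriv v \<eta> (x - t *\<^sub>R w))) (at x)"
        by (rule has_derivative_compose[OF _ has_derivative_partial_deriv[OF schwartz_differentiable[OF \<eta>]]])
          (auto intro!: derivative_eq_intros)
      then show ?thesis
        unfolding ext[of "blinfun_apply (D x t)", OF apply_D] .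
    qed
    show "continuous_on (UNIV \<times> cbox 0 \<nu>) (\<lambda>(x, t). D x t)"
      using cont by (simp add: case_prod_unfold)
  qed (use integrable_on_ray[OF \<eta>] in auto)
  moreover have "blinfun_apply (integral (cbox 0 \<nu>) (D x))
      = (\<lambda>h. \<Sum>v\<in>Basis. (h \<bullet> v) *\<^sub>R ray_average \<nu> w (partial_deriv v \<eta>) x)"
  proof
    fix h
    have "continuous_on (cbox 0 \<nu>) (\<lambda>t. D (fst (x, t)) (snd (x, t)))"
      by (rule continuous_on_compose2[OF cont[of UNIV]]) (auto intro!: continuous_intros)
    then have "D x integrable_on cbox 0 \<nu>"
      by (intro integrable_continuous) simp
    then have "blinfun_apply (integral (cbox 0 \<nu>) (D x)) h = integral (cbox 0 \<nu>) (\<lambda>t. blinfun_apply (D x t) h)"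
      by (subst integral_linear[OF _ blinfun.bounded_linear_left, symmetric]) (auto simp: o_def)
    also have "\<dots> = (\<Sum>v\<in>Basis. integral {0..\<nu>} (\<lambda>t. (h \<bullet> v) *\<^sub>R partial_deriv v \<eta> (x - t *\<^sub>R w)))"
      unfolding apply_D interval_cbox[symmetric]
      by (intro integral_sum integrable_cmul integrable_on_ray schwartz_partial_deriv \<eta>) auto
    finally show "blinfun_apply (integral (cbox 0 \<nu>) (D x)) h
        = (\<Sum>v\<in>Basis. (h \<bullet> v) *\<^sub>R ray_average \<nu> w (partial_deriv v \<eta>) x)"
      by (simp add: ray_average_def)
  qed
  moreover have "ray_average \<nu> w \<eta> = (\<lambda>x. integral (cbox 0 \<nu>) (\<lambda>t. \<eta> (x - t *\<^sub>R w)))"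
    by (simp add: fun_eq_iff ray_average_def)
  ultimately show ?thesis
    by simp
qed

lemma partial_deriv_ray_average:
  assumes "\<eta> \<in> schwartz" "v \<in> Basis"
  shows "partial_deriv v (ray_average \<nu> w \<eta>) = ray_average \<nu> w (partial_deriv v \<eta>)"
  using assms(2)
  by (simp add: fun_eq_iff has_derivative_imp_partial_deriv[OF has_derivative_ray_average[OF assms(1)]]
      inner_Basis if_distrib[of "\<lambda>r. r *\<^sub>R _"] cong: if_cong)

text \<open>All points averaged lie within \<nu> \<bar>w\<bar> of \<open>x\<close>, and the interval
  has length \<nu>. The bound is linear in \<open>C\<close>, so it gives both the decay of the
  average and, with a seminorm as \<open>C\<close>, the continuity of averaging.\<close>

lemma ray_average_bound:
  fixes \<eta> :: "'a::euclidean_space \<Rightarrow> complex"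
  assumes "\<nu> \<ge> 0" "\<eta> \<in> schwartz" and C: "\<And>y. (1 + norm y) ^ k * norm (\<eta> y) \<le> C"
  shows "(1 + norm x) ^ k * norm (ray_average \<nu> w \<eta> x) \<le> \<nu> * (1 + \<nu> * norm w) ^ k * C"
proof -
  have pos: "(1 + norm x) ^ k > 0"
    by (simp add: add_pos_nonneg)
  have "norm (integral {0..\<nu>} (\<lambda>t. \<eta> (x - t *\<^sub>R w)))
      \<le> ((1 + \<nu> * norm w) ^ k * C / (1 + norm x) ^ k) * (\<nu> - 0)"
  proof (rule integral_bound)
    show "continuous_on {0..\<nu>} (\<lambda>t. \<eta> (x - t *\<^sub>R w))"
      by (intro schwartz_continuous_compose[OF assms(2)] continuous_intros)
    fix t
    assume t: "t \<in> {0..\<nu>}"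
    have "1 + norm x \<le> (1 + norm (- (t *\<^sub>R w))) * (1 + norm (x + - (t *\<^sub>R w)))"
      by (rule one_plus_norm_le)
    also have "\<dots> \<le> (1 + \<nu> * norm w) * (1 + norm (x - t *\<^sub>R w))"
      using t by (auto intro!: mult_right_mono)
    finally have "(1 + norm x) ^ k \<le> ((1 + \<nu> * norm w) * (1 + norm (x - t *\<^sub>R w))) ^ k"
      by (rule power_mono) auto
    then have "(1 + norm x) ^ k * norm (\<eta> (x - t *\<^sub>R w))
        \<le> ((1 + \<nu> * norm w) * (1 + norm (x - t *\<^sub>R w))) ^ k * norm (\<eta> (x - t *\<^sub>R w))"
      by (rule mult_right_mono) auto
    also have "\<dots> \<le> (1 + \<nu> * norm w) ^ k * C"
      unfolding power_mult_distrib mult.assoc using assms(1) by (intro mult_left_mono C) auto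
    finally show "norm (\<eta> (x - t *\<^sub>R w)) \<le> (1 + \<nu> * norm w) ^ k * C / (1 + norm x) ^ k"
      using pos by (simp add: pos_le_divide_eq mult.commute)
  qed (use assms in simp)
  then show ?thesis
    using pos by (simp add: ray_average_def pos_le_divide_eq mult_ac)
qed

lemma ray_average_schwartz:
  assumes "\<nu> \<ge> 0" "\<eta> \<in> schwartz"
  shows "ray_average \<nu> w \<eta> \<in> schwartz"
proof -
  have "ray_average \<nu> w \<eta> \<in> ray_average \<nu> w ` schwartz"
    using assms by blast
  then show ?thesis
  proof (rule schwartz_coinduct)
    fix \<zeta> :: "'a \<Rightarrow> complex" and x k and v :: 'a
    assume "\<zeta> \<in> ray_average \<nu> w ` schwartz"
    then obtain \<eta> where \<eta>: "\<eta> \<in> schwartz" "\<zeta> = ray_average \<nu> w \<eta>" by blast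
    show "\<zeta> differentiable (at x)"
      using has_derivative_ray_average \<eta> differentiable_def by blast
    obtain C where "(1 + norm y) ^ k * norm (\<eta> y) \<le> C" for y
      using schwartz_bounded[OF \<eta>(1)] by metis
    then show "\<exists>C. \<forall>x. (1 + norm x) ^ k * norm (\<zeta> x) \<le> C"
      using ray_average_bound[OF assms(1) \<eta>(1)] \<eta>(2) by blast
    show "partial_deriv v \<zeta> \<in> ray_average \<nu> w ` schwartz" if "v \<in> Basis"
      unfolding \<eta> partial_deriv_ray_average[OF \<eta>(1) that]
      by (intro imageI schwartz_partial_deriv \<eta> that)
  qed
qed

text \<open>One induction proves both claims, because moving a further derivative past the average
  uses that the function reached so far is Schwartz.\<close>

lemma iter_partial_ray_average:
  assumes "\<eta> \<in> schwartz" "set vs \<subseteq> Basis"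
  shows "iter_partial vs \<eta> \<in> schwartz \<and>
    iter_partial vs (ray_average \<nu> w \<eta>) = ray_average \<nu> w (iter_partial vs \<eta>)"
  using assms(2)
  by (induction vs) (simp_all add: assms(1) schwartz_partial_deriv partial_deriv_ray_average)

section \<open>Continuity of averaging, and its action on distributions\<close>

lemma schwartz_seminorm_nonneg:
  assumes "\<eta> \<in> schwartz" "set vs \<subseteq> Basis"
  shows "schwartz_seminorm k vs \<eta> \<ge> 0"
  unfolding schwartz_seminorm_def
  by (rule cSUP_upper2[OF schwartz_iter_partial_bounded[OF assms], of 0]) auto

lemma schwartz_seminorm_ray_average:
  assumes "\<nu> \<ge> 0" "\<eta> \<in> schwartz" "set vs \<subseteq> Basis"
  shows "schwartz_seminorm k vs (ray_average \<nu> w \<eta>)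
    \<le> \<nu> * (1 + \<nu> * norm w) ^ k * schwartz_seminorm k vs \<eta>"
  unfolding schwartz_seminorm_def conjunct2[OF iter_partial_ray_average[OF assms(2,3)]]
  by (intro cSUP_least ray_average_bound cSUP_upper schwartz_iter_partial_bounded assms
      conjunct1[OF iter_partial_ray_average]) auto

text \<open>A seminorm of an average is at most a constant times the same seminorm of the function,
  so sequences tending to 0 in \<open>schwartz\<close> still do so after averaging. Two directions
  with coefficients are treated together because this is the shape of the V-line transform.\<close>

lemma tempered_compose_ray_average:
  fixes f :: "('a::euclidean_space \<Rightarrow> complex) \<Rightarrow> complex"
  assumes "\<nu> \<ge> 0" and f: "f \<in> tempered"
  shows "(\<lambda>\<eta>\<in>schwartz. a * f (ray_average \<nu> w \<eta>) + b * f (ray_average \<nu> w' \<eta>)) \<in> tempered"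
proof -
  let ?A = "ray_average \<nu>"
  have lim: "(\<lambda>j. f (?A w (X j))) \<longlonglongrightarrow> 0"
    if X: "\<And>j::nat. X j \<in> schwartz"
      and null: "\<And>k vs. set vs \<subseteq> Basis \<Longrightarrow> (\<lambda>j. schwartz_seminorm k vs (X j)) \<longlonglongrightarrow> 0" for X w
  proof -
    have "(\<lambda>j. schwartz_seminorm k vs (?A w (X j))) \<longlonglongrightarrow> 0" if vs: "set vs \<subseteq> Basis" for k vs
    proof (rule tendsto_sandwich[OF _ _ tendsto_const])
      show "(\<lambda>j. \<nu> * (1 + \<nu> * norm w) ^ k * schwartz_seminorm k vs (X j)) \<longlonglongrightarrow> 0"
        by (rule tendsto_mult_right_zero[OF null[OF vs]])
      show "\<forall>\<^sub>F j in sequentially. 0 \<le> schwartz_seminorm k vs (?A w (X j))"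
        by (intro always_eventually allI schwartz_seminorm_nonneg ray_average_schwartz assms X vs)
      show "\<forall>\<^sub>F j in sequentially. schwartz_seminorm k vs (?A w (X j))
          \<le> \<nu> * (1 + \<nu> * norm w) ^ k * schwartz_seminorm k vs (X j)"
        by (intro always_eventually allI schwartz_seminorm_ray_average assms X vs)
    qed
    then show ?thesis
      using f ray_average_schwartz[OF assms(1) X] by (auto simp: tempered_def)
  qed
  show ?thesis
    unfolding tempered_def
  proof (intro CollectI conjI ballI allI impI)
    fix \<eta> \<zeta> :: "'a \<Rightarrow> complex" and c
    assume S: "\<eta> \<in> schwartz"
    have f_add: "f (\<lambda>x. \<eta> x + \<zeta> x) = f \<eta> + f \<zeta>" if "\<eta> \<in> schwartz" "\<zeta> \<in> schwartz" for \<eta> \<zeta>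
      using f that by (auto simp: tempered_def)
    have f_cmult: "f (\<lambda>x. c * \<eta> x) = c * f \<eta>" if "\<eta> \<in> schwartz" for \<eta>
      using f that by (auto simp: tempered_def)
    let ?u = "\<lambda>\<eta>\<in>schwartz. a * f (?A w \<eta>) + b * f (?A w' \<eta>)"
    show "?u (\<lambda>x. \<eta> x + \<zeta> x) = ?u \<eta> + ?u \<zeta>" if "\<zeta> \<in> schwartz"
      using S that
      by (simp add: schwartz_add ray_average_add f_add ray_average_schwartz assms(1) distrib_left)
    show "?u (\<lambda>x. c * \<eta> x) = c * ?u \<eta>"
      using S
      by (simp add: schwartz_cmult ray_average_cmult f_cmult ray_average_schwartz assms(1)
          distrib_left mult.left_commute)
  next
    fix X :: "nat \<Rightarrow> 'a \<Rightarrow> complex"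
    assume X: "\<forall>j. X j \<in> schwartz"
      and null: "\<forall>k vs. set vs \<subseteq> Basis \<longrightarrow> (\<lambda>j. schwartz_seminorm k vs (X j)) \<longlonglongrightarrow> 0"
    have "(\<lambda>j. a * f (?A w (X j)) + b * f (?A w' (X j))) \<longlonglongrightarrow> a * 0 + b * 0"
      by (intro tendsto_intros lim) (use X null in auto)
    then show "(\<lambda>j. (\<lambda>\<eta>\<in>schwartz. a * f (?A w \<eta>) + b * f (?A w' \<eta>)) (X j)) \<longlonglongrightarrow> 0"
      using X by simp
  qed simp
qed


section \<open>The symbol of the V-line transform\<close>

text \<open>Up to the factor \<open>\<i> ^ j\<close>, the \<open>j\<close>-th derivative of
  \<open>ray_symbol \<nu>\<close>. With arbitrary constant factors the moments thus form a family
  closed under differentiation.\<close>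

definition ray_moment :: "real \<Rightarrow> nat \<Rightarrow> real \<Rightarrow> complex" where
  "ray_moment \<nu> j y = integral {0..\<nu>} (\<lambda>t. of_real (t ^ j) * exp (\<i> * of_real (t * y)))"

lemma ray_moment_0: "ray_moment \<nu> 0 = ray_symbol \<nu>"
  by (simp add: ray_moment_def ray_symbol_def fun_eq_iff)

lemma has_vector_derivative_ray_moment:
  "(ray_moment \<nu> j has_vector_derivative \<i> * ray_moment \<nu> (Suc j) y) (at y)"
proof -
  have "((\<lambda>y. integral (cbox 0 \<nu>) (\<lambda>t. of_real (t ^ j) * exp (\<i> * of_real (t * y)))) has_vector_derivative
      integral (cbox 0 \<nu>) (\<lambda>t. \<i> * (of_real (t ^ Suc j) * exp (\<i> * of_real (t * y))))) (at y within UNIV)"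
  proof (rule leibniz_rule_vector_derivative)
    show "((\<lambda>y. of_real (t ^ j) * exp (\<i> * of_real (t * y))) has_vector_derivative
        \<i> * (of_real (t ^ Suc j) * exp (\<i> * of_real (t * y)))) (at y)" for t y
    proof -
      have "((\<lambda>z. of_real (t ^ j) * exp (\<i> * (of_real t * z))) has_field_derivative
          \<i> * (of_real (t ^ Suc j) * exp (\<i> * of_real (t * y)))) (at (of_real y))"
        by (auto intro!: derivative_eq_intros)
      from has_vector_derivative_real_field[OF this] show ?thesis
        by simp
    qed
  qed (auto intro!: integrable_continuous_interval continuous_intros simp: case_prod_unfold)
  then show ?thesis
    by (simp add: ray_moment_def[abs_def])
qed

lemma norm_ray_moment_le:
  assumes "\<nu> \<ge> 0"
  shows "norm (ray_moment \<nu> j y) \<le> \<nu> ^ Suc j"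
proof -
  have "norm (ray_moment \<nu> j y) \<le> \<nu> ^ j * (\<nu> - 0)"
    unfolding ray_moment_def
  proof (rule integral_bound)
    show "norm (of_real (t ^ j) * exp (\<i> * of_real (t * y))) \<le> \<nu> ^ j" if "t \<in> {0..\<nu>}" for t
      using that by (auto simp: norm_mult norm_power norm_exp_eq_Re intro!: power_mono)
  qed (use assms in \<open>auto intro!: continuous_intros\<close>)
  then show ?thesis
    by (simp add: mult.commute)
qed

text \<open>A derivative raises \<open>j\<close> by one and changes only \<open>c\<close>. Every
  moment is bounded, as \<open>t\<close> ranges over a bounded interval, so growth exponent 0
  suffices.\<close>

lemma multipliers_ray_moment:
  fixes w :: "'a::euclidean_space"
  assumes "\<nu> \<ge> 0"
  shows "multipliers {\<lambda>\<xi>::'a. c * ray_moment \<nu> j (\<xi> \<bullet> w) |c j. True}"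
proof
  fix h :: "'a \<Rightarrow> complex" and x
  assume "h \<in> {\<lambda>\<xi>. c * ray_moment \<nu> j (\<xi> \<bullet> w) |c j. True}"
  then obtain c j where h: "h = (\<lambda>\<xi>. c * ray_moment \<nu> j (\<xi> \<bullet> w))" by blast
  have D: "(h has_derivative (\<lambda>y. c * ((y \<bullet> w) *\<^sub>R (\<i> * ray_moment \<nu> (Suc j) (x \<bullet> w))))) (at x)" for x
    unfolding h
    by (intro has_derivative_mult_right has_derivative_compose[OF _
          has_vector_derivative_ray_moment[unfolded has_vector_derivative_def]])
      (auto intro!: derivative_eq_intros)
  then show "h differentiable (at x)"
    using differentiable_def by blast
  have "norm (h x) \<le> (norm c * \<nu> ^ Suc j) * (1 + norm x) ^ 0" for x
    unfolding h norm_mult using norm_ray_moment_le[OF assms] by (simp add: mult_left_mono del: power_Suc)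
  then show "\<exists>k C. \<forall>x. norm (h x) \<le> C * (1 + norm x) ^ k" by blast
  fix v :: 'a
  have "partial_deriv v h = (\<lambda>\<xi>. (c * of_real (v \<bullet> w) * \<i>) * ray_moment \<nu> (Suc j) (\<xi> \<bullet> w))"
    by (simp add: fun_eq_iff has_derivative_imp_partial_deriv[OF D] scaleR_conv_of_real mult_ac)
  then show "partial_deriv v h \<in> {\<lambda>\<xi>. c * ray_moment \<nu> j (\<xi> \<bullet> w) |c j. True}" by blast
qed

lemma schwartz_mult_ray_symbol:
  assumes "\<nu> \<ge> 0" "\<eta> \<in> schwartz"
  shows "(\<lambda>\<xi>. ray_symbol \<nu> (\<xi> \<bullet> w) * \<eta> \<xi>) \<in> schwartz"
proof -
  have "(\<lambda>\<xi>. 1 * ray_moment \<nu> 0 (\<xi> \<bullet> w) * \<eta> \<xi>) \<in> schwartz"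
    by (rule multipliers.schwartz_mult[OF multipliers_ray_moment[OF assms(1), of w] _ assms(2)]) blast
  then show ?thesis
    by (simp add: ray_moment_0)
qed

lemma ray_symbol_measurable [measurable]: "ray_symbol \<nu> \<in> borel_measurable borel"
proof (rule borel_measurable_continuous_onI)
  show "continuous_on UNIV (ray_symbol \<nu>)"
    unfolding ray_moment_0[symmetric]
    by (meson continuous_at_imp_continuous_on has_vector_derivative_continuous has_vector_derivative_ray_moment)
qed

text \<open>Multiplying by exp(i t (y \<bullet> w)) before transforming evaluates the transform at x
  - t w, and the symbol integrates these factors over \<open>t\<close>. Fubini applies because the
  modulus of the integrand is \<bar>\<eta>(y)\<bar> on a strip of width \<nu>.\<close>

lemma fourier_ray_symbol:
  fixes \<eta> :: "'a::euclidean_space \<Rightarrow> complex"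
  assumes "\<nu> \<ge> 0" and \<eta>: "\<eta> \<in> schwartz"
  shows "fourier (\<lambda>\<xi>. ray_symbol \<nu> (\<xi> \<bullet> w) * \<eta> \<xi>) = ray_average \<nu> w (fourier \<eta>)"
proof
  fix x :: 'a
  define F where "F = (\<lambda>y t. indicator {0..\<nu>} t *\<^sub>R (exp (- (\<i> * of_real (y \<bullet> (x - t *\<^sub>R w)))) * \<eta> y))"
  have [measurable]: "\<eta> \<in> borel_measurable borel"
    using \<eta> by (rule schwartz_measurable)
  have norm_F: "norm (F y t) = indicator {0..\<nu>} t * norm (\<eta> y)" for y t
    by (simp add: F_def norm_mult norm_exp_minus_i_times)
  have F_y: "set_integrable lborel {0..\<nu>} (\<lambda>t. exp (- (\<i> * of_real (y \<bullet> (x - t *\<^sub>R w)))) * \<eta> y)" for y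
    by (intro borel_integrable_atLeastAtMost' continuous_intros)
  have int: "integrable (lborel \<Otimes>\<^sub>M lborel) (\<lambda>(y, t). F y t)"
  proof (rule lborel_pair.Fubini_integrable)
    show "(\<lambda>(y, t). F y t) \<in> borel_measurable (lborel \<Otimes>\<^sub>M lborel)"
      unfolding F_def by measurable
    show "integrable lborel (\<lambda>y. LINT t|lborel. norm (case (y, t) of (y, t) \<Rightarrow> F y t))"
      using schwartz_integrable[OF \<eta>] by (simp add: norm_F)
    show "AE y in lborel. integrable lborel (\<lambda>t. case (y, t) of (y, t) \<Rightarrow> F y t)"
      using F_y by (simp add: F_def set_integrable_def)
  qed
  have "fourier (\<lambda>\<xi>. ray_symbol \<nu> (\<xi> \<bullet> w) * \<eta> \<xi>) x = (LINT y|lborel. LINT t|lborel. F y t)"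
    unfolding fourier_def
  proof (intro Bochner_Integration.integral_cong refl)
    fix y
    have "(LINT t|lborel. F y t) = integral {0..\<nu>} (\<lambda>t. exp (- (\<i> * of_real (y \<bullet> (x - t *\<^sub>R w)))) * \<eta> y)"
      using set_borel_integral_eq_integral(2)[OF F_y[of y]]
      unfolding F_def set_lebesgue_integral_def .
    also have "(\<lambda>t. exp (- (\<i> * of_real (y \<bullet> (x - t *\<^sub>R w)))) * \<eta> y)
        = (\<lambda>t. (exp (- (\<i> * of_real (y \<bullet> x))) * \<eta> y) * exp (\<i> * of_real (t * (y \<bullet> w))))"
      by (simp add: fun_eq_iff inner_diff_right right_diff_distrib exp_diff exp_minus field_simps)
    finally show "exp (- (\<i> * of_real (y \<bullet> x))) * (ray_symbol \<nu> (y \<bullet> w) * \<eta> y) = (LINT t|lborel. F y t)"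
      by (simp add: ray_symbol_def)
  qed
  also have "\<dots> = (LINT t|lborel. LINT y|lborel. F y t)"
    by (rule lborel_pair.Fubini_integral[OF int, symmetric])
  also have "\<dots> = (LINT t:{0..\<nu>}|lborel. fourier \<eta> (x - t *\<^sub>R w))"
    by (simp add: F_def fourier_def set_lebesgue_integral_def)
  also have "\<dots> = ray_average \<nu> w (fourier \<eta>) x"
    unfolding ray_average_def
    by (intro set_borel_integral_eq_integral borel_integrable_atLeastAtMost'
        schwartz_continuous_compose[OF fourier_schwartz[OF \<eta>]] continuous_intros)
  finally show "fourier (\<lambda>\<xi>. ray_symbol \<nu> (\<xi> \<bullet> w) * \<eta> \<xi>) x = ray_average \<nu> w (fourier \<eta>) x" .
qed

text \<open>The term \<nu>^2 is the trivial bound for \<bar>m(y)\<bar>^2; the 4 bounds \<bar>y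
  m(y)\<bar>^2, since i y m(y) = exp(i \<nu> y) - 1 has modulus at most 2. Adding the two avoids a
  division by \<open>y\<close>.\<close>

lemma norm_ray_symbol_sq_le:
  assumes "\<nu> \<ge> 0"
  shows "(norm (ray_symbol \<nu> y))\<^sup>2 \<le> (\<nu>\<^sup>2 + 4) * (1 + y\<^sup>2) powr (- 1)"
proof -
  have "((\<lambda>t. \<i> * of_real y * exp (\<i> * of_real (t * y))) has_integral
      exp (\<i> * of_real (\<nu> * y)) - exp (\<i> * of_real (0 * y))) {0..\<nu>}"
  proof (rule fundamental_theorem_of_calculus[OF assms])
    fix t
    have "((\<lambda>z. exp (\<i> * (z * of_real y))) has_field_derivative
        \<i> * of_real y * exp (\<i> * of_real (t * y))) (at (of_real t))"
      by (auto intro!: derivative_eq_intros)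
    from has_vector_derivative_real_field[OF this]
    show "((\<lambda>t. exp (\<i> * of_real (t * y))) has_vector_derivative
        \<i> * of_real y * exp (\<i> * of_real (t * y))) (at t within {0..\<nu>})"
      by simp
  qed
  then have "\<i> * of_real y * ray_symbol \<nu> y = exp (\<i> * of_real (\<nu> * y)) - 1"
    unfolding ray_symbol_def by (simp flip: integral_mult_right add: integral_unique)
  then have "\<bar>y\<bar> * norm (ray_symbol \<nu> y) = norm (exp (\<i> * of_real (\<nu> * y)) - 1)"
    by (metis mult_1 norm_ii norm_mult norm_of_real)
  also have "\<dots> \<le> 2"
    by (rule order_trans[OF norm_triangle_ineq4]) (simp add: norm_exp_eq_Re)
  finally have "(\<bar>y\<bar> * norm (ray_symbol \<nu> y))\<^sup>2 \<le> 2\<^sup>2"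
    by (rule power_mono) simp
  moreover have "(norm (ray_symbol \<nu> y))\<^sup>2 \<le> \<nu>\<^sup>2"
    using norm_ray_moment_le[OF assms, of 0 y] by (simp add: ray_moment_0 power_mono)
  ultimately have "(1 + y\<^sup>2) * (norm (ray_symbol \<nu> y))\<^sup>2 \<le> \<nu>\<^sup>2 + 4"
    by (simp add: power_mult_distrib distrib_right)
  moreover have "1 + y\<^sup>2 > 0"
    by (simp add: add_pos_nonneg)
  ultimately show ?thesis
    by (simp add: powr_minus inverse_eq_divide pos_le_divide_eq mult.commute)
qed


section \<open>Square integrability of the symbol\<close>

text \<open>\<open>lborel\<close> is the image of a product measure indexed by \<open>Basis\<close>.
  Naming the basis vectors abstractly lets either axis take the role of the inner variable.\<close>

lemma nn_integral_lborel_two_dim: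
  fixes e e' :: "'a::euclidean_space" and G :: "real \<Rightarrow> real \<Rightarrow> ennreal"
  assumes B: "Basis = {e, e'}" "e \<noteq> e'"
    and G: "case_prod G \<in> borel_measurable (borel \<Otimes>\<^sub>M borel)"
  shows "(\<integral>\<^sup>+\<xi>. G (\<xi> \<bullet> e) (\<xi> \<bullet> e') \<partial>lborel) = (\<integral>\<^sup>+y. \<integral>\<^sup>+x. G x y \<partial>lborel \<partial>lborel)"
proof -
  have e: "e \<in> Basis" "e' \<in> Basis"
    using B by auto
  interpret product_sigma_finite "\<lambda>_::'a. lborel :: real measure" ..
  have [measurable]: "case_prod G \<in> borel_measurable (lborel \<Otimes>\<^sub>M lborel)"
    using G by simp
  have G': "(\<lambda>p. G (fst p) (snd p)) \<in> borel_measurable (borel \<Otimes>\<^sub>M borel)"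
    using G by (simp add: case_prod_unfold)
  have [measurable]: "(\<lambda>\<xi>. G (\<xi> \<bullet> e) (\<xi> \<bullet> e')) \<in> borel_measurable borel"
    using measurable_compose[OF measurable_Pair G', of "\<lambda>\<xi>. \<xi> \<bullet> e" borel "\<lambda>\<xi>. \<xi> \<bullet> e'"] by simp
  have "(\<integral>\<^sup>+\<xi>. G (\<xi> \<bullet> e) (\<xi> \<bullet> e') \<partial>lborel) = (\<integral>\<^sup>+\<sigma>. G (\<sigma> e) (\<sigma> e') \<partial>PiM {e, e'} (\<lambda>_. lborel))"
    by (subst lborel_eq, subst nn_integral_distr) (simp_all add: B e inner_add_left inner_same_Basis inner_not_same_Basis B(2)[symmetric])
  also have "\<dots> = (\<integral>\<^sup>+z. G (fst z) (snd z) \<partial>(lborel \<Otimes>\<^sub>M lborel))"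
    by (rule product_nn_integral_pair) (use B in auto)
  also have "\<dots> = (\<integral>\<^sup>+y. \<integral>\<^sup>+x. G x y \<partial>lborel \<partial>lborel)"
    by (subst lborel_pair.nn_integral_snd[symmetric]) (simp_all add: case_prod_unfold[symmetric])
  finally show ?thesis .
qed

text \<open>The weight decays in the coordinate along \<open>e'\<close>, uniformly in the coordinate along \<open>e\<close>, in which
  the second factor is integrated first.\<close>

lemma nn_integral_weight_ray_finite:
  fixes e e' w :: "'a::euclidean_space"
  assumes B: "Basis = {e, e'}" "e \<noteq> e'" and w: "w \<bullet> e \<noteq> 0" and \<gamma>: "\<gamma> > 1 / 2"
  shows "(\<integral>\<^sup>+\<xi>. ennreal ((1 + (norm \<xi>)\<^sup>2) powr (- \<gamma>) * (1 + (\<xi> \<bullet> w)\<^sup>2) powr (- 1)) \<partial>lborel) < \<infinity>"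
proof -
  let ?c = "w \<bullet> e" and ?s = "w \<bullet> e'"
  let ?k = "\<lambda>y::real. ennreal ((1 + y\<^sup>2) powr (- 1))"
  define G where "G = (\<lambda>x y. ennreal ((1 + y\<^sup>2) powr (- \<gamma>)) * ?k (?s * y + ?c * x))"
  define K where "K = (\<integral>\<^sup>+y. ?k y \<partial>lborel)"
  have K: "K < \<infinity>"
    unfolding K_def by (rule nn_integral_one_plus_square_powr_finite) simp
  \<comment> \<open>Translation invariance removes the shift \<open>y\<close>, and scaling
    contributes 1/\<bar>w \<bullet> e\<bar>; the value is thus the same on every line parallel to
    \<open>e\<close>.\<close>
  have inner: "(\<integral>\<^sup>+x. ?k (y + ?c * x) \<partial>lborel) = K / \<bar>?c\<bar>" for y
  proof -
    let ?I = "\<integral>\<^sup>+x. ?k (y + ?c * x) \<partial>lborel"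
    have "K = \<bar>?c\<bar> * ?I"
      unfolding K_def using w by (intro nn_integral_real_affine) auto
    moreover have "?I * \<bar>?c\<bar> / \<bar>?c\<bar> = ?I"
      using w by (intro ennreal_mult_divide_eq) auto
    ultimately show ?thesis
      by (simp only: mult.commute)
  qed
  have "(\<integral>\<^sup>+\<xi>. ennreal ((1 + (norm \<xi>)\<^sup>2) powr (- \<gamma>) * (1 + (\<xi> \<bullet> w)\<^sup>2) powr (- 1)) \<partial>lborel)
      \<le> (\<integral>\<^sup>+\<xi>. G (\<xi> \<bullet> e) (\<xi> \<bullet> e') \<partial>lborel)"
  proof (rule nn_integral_mono)
    fix \<xi> :: 'a
    have "\<xi> \<bullet> w = ?s * (\<xi> \<bullet> e') + ?c * (\<xi> \<bullet> e)"
      unfolding euclidean_inner[of \<xi> w] B(1) using B(2) by (simp add: mult.commute add.commute)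
    moreover have "(1 + (norm \<xi>)\<^sup>2) powr (- \<gamma>) \<le> (1 + (\<xi> \<bullet> e')\<^sup>2) powr (- \<gamma>)"
    proof (rule powr_mono2')
      have "\<bar>\<xi> \<bullet> e'\<bar> \<le> norm \<xi>"
        using B by (intro Basis_le_norm) auto
      then show "1 + (\<xi> \<bullet> e')\<^sup>2 \<le> 1 + (norm \<xi>)\<^sup>2"
        using power_mono[of "\<bar>\<xi> \<bullet> e'\<bar>" "norm \<xi>" 2] by simp
    qed (use \<gamma> in \<open>auto simp: add_pos_nonneg\<close>)
    ultimately show "ennreal ((1 + (norm \<xi>)\<^sup>2) powr (- \<gamma>) * (1 + (\<xi> \<bullet> w)\<^sup>2) powr (- 1)) \<le> G (\<xi> \<bullet> e) (\<xi> \<bullet> e')"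
      unfolding G_def by (subst ennreal_mult[symmetric]) (auto intro!: ennreal_leI divide_right_mono)
  qed
  also have "\<dots> = (\<integral>\<^sup>+y. \<integral>\<^sup>+x. G x y \<partial>lborel \<partial>lborel)"
    unfolding G_def by (intro nn_integral_lborel_two_dim B) measurable
  also have "\<dots> = (\<integral>\<^sup>+y. ennreal ((1 + y\<^sup>2) powr (- \<gamma>)) * (K / \<bar>?c\<bar>) \<partial>lborel)"
  proof (rule nn_integral_cong)
    show "(\<integral>\<^sup>+x. G x y \<partial>lborel) = ennreal ((1 + y\<^sup>2) powr (- \<gamma>)) * (K / \<bar>?c\<bar>)" for y
      unfolding G_def inner[of "?s * y", symmetric] by (rule nn_integral_cmult) measurable
  qed
  also have "\<dots> = (\<integral>\<^sup>+y. ennreal ((1 + y\<^sup>2) powr (- \<gamma>)) \<partial>lborel) * (K / \<bar>?c\<bar>)"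
    by (rule nn_integral_multc) simp
  also have "\<dots> < \<infinity>"
    using nn_integral_one_plus_square_powr_finite[OF \<gamma>] K w
    by (simp add: divide_ennreal_def inverse_ennreal ennreal_mult_less_top)
  finally show ?thesis .
qed

text \<open>Cosine and sine do not vanish together, so the direction has a nonzero component along
  one of the axes; that axis becomes \<open>e\<close>.\<close>

lemma nn_integral_weight_vline_dir_finite:
  assumes "\<gamma> > 1 / 2"
  shows "(\<integral>\<^sup>+\<xi>. ennreal ((1 + (norm \<xi>)\<^sup>2) powr (- \<gamma>) * (1 + (\<xi> \<bullet> vline_dir \<theta>)\<^sup>2) powr (- 1)) \<partial>lborel) < \<infinity>"
proof -
  have B: "Basis = {axis 1 1, axis 2 (1::real) :: real ^ 2}"
    by (auto simp: Basis_vec_def UNIV_2)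
  have ne: "axis 1 1 \<noteq> (axis 2 1 :: real ^ 2)"
    by (simp add: axis_eq_axis)
  have "cos (\<theta> - pi / 2) \<noteq> 0 \<or> sin (\<theta> - pi / 2) \<noteq> 0"
    by (metis sin_zero_abs_cos_one abs_zero zero_neq_one)
  then have "vline_dir \<theta> \<bullet> axis 1 1 \<noteq> 0 \<or> vline_dir \<theta> \<bullet> axis 2 1 \<noteq> 0"
    by (simp add: inner_axis vline_dir_def)
  then show ?thesis
    using nn_integral_weight_ray_finite[OF B ne _ assms]
      nn_integral_weight_ray_finite[OF B[unfolded insert_commute[of _ "axis 2 1"]] ne[symmetric] _ assms]
    by blast
qed

lemma vline_symbol_measurable [measurable]: "vline_symbol a b \<psi> \<nu> \<phi> \<in> borel_measurable borel"
  unfolding vline_symbol_def[abs_def] by measurable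

text \<open>The inequality (p + q)^2 \<le> 2 p^2 + 2 q^2 separates the two rays and accounts for the
  factor 2 in \<open>?A\<close> and \<open>?B\<close>.\<close>

lemma nn_integral_weight_vline_symbol_finite:
  assumes "\<nu> \<ge> 0" "\<gamma> > 1 / 2"
  shows "(\<integral>\<^sup>+\<xi>. ennreal ((1 + (norm \<xi>)\<^sup>2) powr (- \<gamma>) * (norm (vline_symbol a b \<psi> \<nu> \<phi> \<xi>))\<^sup>2) \<partial>lborel) < \<infinity>"
proof -
  let ?W = "\<lambda>\<theta> \<xi>. (1 + (norm \<xi>)\<^sup>2) powr (- \<gamma>) * (1 + (\<xi> \<bullet> vline_dir \<theta>)\<^sup>2) powr (- 1)"
  let ?A = "2 * a\<^sup>2 * (\<nu>\<^sup>2 + 4)" and ?B = "2 * b\<^sup>2 * (\<nu>\<^sup>2 + 4)"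
  have "(\<integral>\<^sup>+\<xi>. ennreal ((1 + (norm \<xi>)\<^sup>2) powr (- \<gamma>) * (norm (vline_symbol a b \<psi> \<nu> \<phi> \<xi>))\<^sup>2) \<partial>lborel)
      \<le> (\<integral>\<^sup>+\<xi>. ennreal ?A * ennreal (?W (\<phi> + 2 * \<psi>) \<xi>) + ennreal ?B * ennreal (?W \<phi> \<xi>) \<partial>lborel)"
  proof (rule nn_integral_mono)
    fix \<xi> :: "real ^ 2"
    let ?m = "ray_symbol \<nu> (\<xi> \<bullet> vline_dir (\<phi> + 2 * \<psi>))" and ?n = "ray_symbol \<nu> (\<xi> \<bullet> vline_dir \<phi>)"
    have "norm (vline_symbol a b \<psi> \<nu> \<phi> \<xi>) \<le> \<bar>a\<bar> * norm ?m + \<bar>b\<bar> * norm ?n"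
      unfolding vline_symbol_def by (rule order_trans[OF norm_triangle_ineq]) (simp add: norm_mult)
    then have "(norm (vline_symbol a b \<psi> \<nu> \<phi> \<xi>))\<^sup>2 \<le> (\<bar>a\<bar> * norm ?m + \<bar>b\<bar> * norm ?n)\<^sup>2"
      by (rule power_mono) simp
    also have "\<dots> \<le> 2 * (\<bar>a\<bar> * norm ?m)\<^sup>2 + 2 * (\<bar>b\<bar> * norm ?n)\<^sup>2"
      using sum_squares_bound[of "\<bar>a\<bar> * norm ?m" "\<bar>b\<bar> * norm ?n"] by (simp add: power2_sum)
    also have "\<dots> = 2 * a\<^sup>2 * (norm ?m)\<^sup>2 + 2 * b\<^sup>2 * (norm ?n)\<^sup>2"
      by (simp add: power_mult_distrib)
    also have "\<dots> \<le> 2 * a\<^sup>2 * ((\<nu>\<^sup>2 + 4) * (1 + (\<xi> \<bullet> vline_dir (\<phi> + 2 * \<psi>))\<^sup>2) powr (- 1))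
        + 2 * b\<^sup>2 * ((\<nu>\<^sup>2 + 4) * (1 + (\<xi> \<bullet> vline_dir \<phi>)\<^sup>2) powr (- 1))"
      using assms(1) by (intro add_mono mult_left_mono norm_ray_symbol_sq_le) auto
    finally have "(1 + (norm \<xi>)\<^sup>2) powr (- \<gamma>) * (norm (vline_symbol a b \<psi> \<nu> \<phi> \<xi>))\<^sup>2
        \<le> (1 + (norm \<xi>)\<^sup>2) powr (- \<gamma>) * \<dots>"
      by (rule mult_left_mono) simp
    also have "\<dots> = ?A * ?W (\<phi> + 2 * \<psi>) \<xi> + ?B * ?W \<phi> \<xi>"
      by (simp only: distrib_left distrib_right mult_ac)
    finally show "ennreal ((1 + (norm \<xi>)\<^sup>2) powr (- \<gamma>) * (norm (vline_symbol a b \<psi> \<nu> \<phi> \<xi>))\<^sup>2)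
        \<le> ennreal ?A * ennreal (?W (\<phi> + 2 * \<psi>) \<xi>) + ennreal ?B * ennreal (?W \<phi> \<xi>)"
      by (simp add: ennreal_leI flip: ennreal_mult ennreal_plus)
  qed
  also have "\<dots> = ennreal ?A * (\<integral>\<^sup>+\<xi>. ennreal (?W (\<phi> + 2 * \<psi>) \<xi>) \<partial>lborel)
      + ennreal ?B * (\<integral>\<^sup>+\<xi>. ennreal (?W \<phi> \<xi>) \<partial>lborel)"
    by (simp add: nn_integral_add nn_integral_cmult)
  also have "\<dots> < \<infinity>"
    using nn_integral_weight_vline_dir_finite[OF assms(2)] by (simp add: ennreal_mult_less_top)
  finally show ?thesis .
qed


section \<open>Sobolev regularity\<close>

lemma schwartz_mult_vline_symbol:
  assumes "\<nu> \<ge> 0" "\<eta> \<in> schwartz"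
  shows "(\<lambda>\<xi>. vline_symbol a b \<psi> \<nu> \<phi> \<xi> * \<eta> \<xi>) \<in> schwartz"
  unfolding vline_symbol_def distrib_right mult.assoc
  by (intro schwartz_add schwartz_cmult schwartz_mult_ray_symbol assms)

text \<open>A choice operator yields its property only once a witness is found. Here
  \<open>u\<close> is that witness: on \<open>fourier \<eta>\<close> it averages, and
  \<open>fourier_ray_symbol\<close> turns the averages into transforms of products with the
  symbol.\<close>

lemma vline_transform_spec:
  assumes "\<nu> \<ge> 0" and f: "f \<in> tempered"
  shows "vline_transform a b \<psi> \<nu> f \<phi> \<in> tempered \<and>
    fourier_distr (vline_transform a b \<psi> \<nu> f \<phi>) = mult_distr (vline_symbol a b \<psi> \<nu> \<phi>) (fourier_distr f)"
proof -
  let ?w = "vline_dir (\<phi> + 2 * \<psi>)" and ?w' = "vline_dir \<phi>"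
  define u where
    "u = (\<lambda>\<eta>\<in>schwartz. of_real a * f (ray_average \<nu> ?w \<eta>) + of_real b * f (ray_average \<nu> ?w' \<eta>))"
  have "u \<in> tempered"
    unfolding u_def by (rule tempered_compose_ray_average[OF assms])
  moreover have "fourier_distr u = mult_distr (vline_symbol a b \<psi> \<nu> \<phi>) (fourier_distr f)"
  proof -
    have "u (fourier \<eta>) = f (fourier (\<lambda>\<xi>. vline_symbol a b \<psi> \<nu> \<phi> \<xi> * \<eta> \<xi>))" if \<eta>: "\<eta> \<in> schwartz" for \<eta>
    proof -
      let ?m = "\<lambda>w \<xi>. ray_symbol \<nu> (\<xi> \<bullet> w) * \<eta> \<xi>"
      have m: "?m w \<in> schwartz" for w
        by (rule schwartz_mult_ray_symbol[OF assms(1) \<eta>])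
      have "fourier (\<lambda>\<xi>. vline_symbol a b \<psi> \<nu> \<phi> \<xi> * \<eta> \<xi>)
          = (\<lambda>x. of_real a * fourier (?m ?w) x + of_real b * fourier (?m ?w') x)"
        by (simp add: vline_symbol_def distrib_right mult.assoc fourier_add fourier_cmult schwartz_cmult m)
      then have "f (fourier (\<lambda>\<xi>. vline_symbol a b \<psi> \<nu> \<phi> \<xi> * \<eta> \<xi>))
          = f (\<lambda>x. of_real a * fourier (?m ?w) x + of_real b * fourier (?m ?w') x)"
        by simp
      also have "\<dots> = of_real a * f (fourier (?m ?w)) + of_real b * f (fourier (?m ?w'))"
        using f by (simp add: tempered_def schwartz_cmult fourier_schwartz m)
      finally show ?thesis
        by (simp add: u_def fourier_schwartz \<eta> fourier_ray_symbol assms(1))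
    qed
    \<comment> \<open>Both sides are \<open>undefined\<close> outside \<open>schwartz\<close>, so
      agreement on Schwartz functions is equality.\<close>
    then show ?thesis
      by (auto simp: fourier_distr_def mult_distr_def fun_eq_iff schwartz_mult_vline_symbol assms(1))
  qed
  ultimately show ?thesis
    unfolding vline_transform_def
    by (intro someI[of "\<lambda>u. u \<in> tempered \<and> fourier_distr u = mult_distr (vline_symbol a b \<psi> \<nu> \<phi>) (fourier_distr f)" u]) simp
qed

text \<open>Testing h g against \<eta> is testing g against h \<eta>, again a test function; this
  gives the integrability as well as the value.\<close>

lemma is_function_distr_mult:
  assumes g: "is_function_distr T g" and h: "h \<in> borel_measurable borel"
    and mult: "\<And>\<eta>. \<eta> \<in> schwartz \<Longrightarrow> (\<lambda>\<xi>. h \<xi> * \<eta> \<xi>) \<in> schwartz"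
  shows "is_function_distr (mult_distr h T) (\<lambda>\<xi>. h \<xi> * g \<xi>)"
proof -
  have eq: "h \<xi> * g \<xi> * \<eta> \<xi> = g \<xi> * (h \<xi> * \<eta> \<xi>)" for \<eta> \<xi>
    by simp
  show ?thesis
    using g h mult unfolding is_function_distr_def mult_distr_def eq
    by (auto simp: fun_eq_iff)
qed

theorem theorem4p2:
  fixes a b \<psi> \<nu> \<alpha> \<beta> \<phi> :: real
    and f :: "(real ^ 2 \<Rightarrow> complex) \<Rightarrow> complex"
  assumes "2 * \<psi> \<in> {0<..<pi}"
    and "\<nu> > 0"
    and "\<phi> \<in> {-pi..pi}"
    and "f \<in> H_space \<beta> \<infinity>"
    and "\<alpha> < \<beta> - 1 / 2"
  shows "vline_transform a b \<psi> \<nu> f \<phi> \<in> H_space \<alpha> 2"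
proof -
  let ?u = "vline_transform a b \<psi> \<nu> f \<phi>" and ?h = "vline_symbol a b \<psi> \<nu> \<phi>"
  have \<nu>: "\<nu> \<ge> 0"
    using assms(2) by simp
  obtain g where f: "f \<in> tempered" and g: "is_function_distr (fourier_distr f) g"
    and g_fin: "esssup lborel (\<lambda>\<xi>. ennreal (norm (of_real ((1 + (norm \<xi>)\<^sup>2) powr (\<beta> / 2)) * g \<xi>))) < \<infinity>"
    using assms(4) by (auto simp: H_space_def Lp_norm_def)
  have u: "?u \<in> tempered" "fourier_distr ?u = mult_distr ?h (fourier_distr f)"
    using vline_transform_spec[OF \<nu> f] by auto
  have "is_function_distr (fourier_distr ?u) (\<lambda>\<xi>. ?h \<xi> * g \<xi>)"
    unfolding u(2) by (intro is_function_distr_mult g schwartz_mult_vline_symbol \<nu>) simp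
  moreover have "Lp_norm 2 (\<lambda>\<xi>. of_real ((1 + (norm \<xi>)\<^sup>2) powr (\<alpha> / 2)) * (?h \<xi> * g \<xi>)) < \<infinity>"
  proof -
    \<comment> \<open>The essential supremum is finite, so passing to a real number loses
      nothing.\<close>
    define C where "C = enn2real (esssup lborel (\<lambda>\<xi>. ennreal (norm (of_real ((1 + (norm \<xi>)\<^sup>2) powr (\<beta> / 2)) * g \<xi>))))"
    have C: "C \<ge> 0" "AE \<xi> in lborel. (1 + (norm \<xi>)\<^sup>2) powr (\<beta> / 2) * norm (g \<xi>) \<le> C"
    proof -
      show "C \<ge> 0"
        by (simp add: C_def)
      have C_eq: "ennreal C = esssup lborel (\<lambda>\<xi>. ennreal (norm (of_real ((1 + (norm \<xi>)\<^sup>2) powr (\<beta> / 2)) * g \<xi>)))"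
        using g_fin by (simp add: C_def)
      have "AE \<xi> in lborel. ennreal (norm (of_real ((1 + (norm \<xi>)\<^sup>2) powr (\<beta> / 2)) * g \<xi>)) \<le> ennreal C"
        unfolding C_eq by (rule esssup_AE)
      then show "AE \<xi> in lborel. (1 + (norm \<xi>)\<^sup>2) powr (\<beta> / 2) * norm (g \<xi>) \<le> C"
        using \<open>C \<ge> 0\<close> by (simp add: norm_mult)
    qed
    let ?G = "\<lambda>\<xi>. (1 + (norm \<xi>)\<^sup>2) powr (- (\<beta> - \<alpha>)) * (norm (?h \<xi>))\<^sup>2"
    have "(\<integral>\<^sup>+\<xi>. ennreal ((norm (of_real ((1 + (norm \<xi>)\<^sup>2) powr (\<alpha> / 2)) * (?h \<xi> * g \<xi>)))\<^sup>2) \<partial>lborel)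
        \<le> (\<integral>\<^sup>+\<xi>. ennreal (C\<^sup>2) * ennreal (?G \<xi>) \<partial>lborel)"
    proof (rule nn_integral_mono_AE, rule AE_mp[OF C(2)], rule AE_I2, rule impI)
      fix \<xi> :: "real ^ 2"
      let ?j = "1 + (norm \<xi>)\<^sup>2"
      assume le: "?j powr (\<beta> / 2) * norm (g \<xi>) \<le> C"
      have j: "?j > 0"
        by (simp add: add_pos_nonneg)
      have sq: "(?j powr (r / 2))\<^sup>2 = ?j powr r" for r
        using j by (simp add: powr_power)
      have "(norm (of_real (?j powr (\<alpha> / 2)) * (?h \<xi> * g \<xi>)))\<^sup>2 = ?j powr \<alpha> * (norm (?h \<xi>))\<^sup>2 * (norm (g \<xi>))\<^sup>2"
        by (simp add: norm_mult power_mult_distrib sq)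
      \<comment> \<open>The exponent is split as \<alpha> = -(\<beta> - \<alpha>) + \<beta>: the
        part \<beta> is spent on the bound for \<open>g\<close>, and \<beta> - \<alpha> is the
        \<gamma> of the integral over the symbol.\<close>
      also have "?j powr \<alpha> = ?j powr (- (\<beta> - \<alpha>)) * (?j powr (\<beta> / 2))\<^sup>2"
        unfolding sq by (simp flip: powr_add)
      also have "\<dots> * (norm (?h \<xi>))\<^sup>2 * (norm (g \<xi>))\<^sup>2 = (?j powr (\<beta> / 2) * norm (g \<xi>))\<^sup>2 * ?G \<xi>"
        by (simp add: power_mult_distrib mult_ac)
      also have "\<dots> \<le> C\<^sup>2 * ?G \<xi>"
        using le by (intro mult_right_mono power_mono) auto
      finally show "ennreal ((norm (of_real (?j powr (\<alpha> / 2)) * (?h \<xi> * g \<xi>)))\<^sup>2) \<le> ennreal (C\<^sup>2) * ennreal (?G \<xi>)"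
        by (simp add: ennreal_leI flip: ennreal_mult)
    qed
    also have "\<dots> = ennreal (C\<^sup>2) * (\<integral>\<^sup>+\<xi>. ennreal (?G \<xi>) \<partial>lborel)"
      by (rule nn_integral_cmult) measurable
    also have "\<dots> < \<infinity>"
      using nn_integral_weight_vline_symbol_finite[OF \<nu>, of "\<beta> - \<alpha>" a b \<psi> \<phi>] assms(5)
      by (simp add: ennreal_mult_less_top)
    \<comment> \<open>When the integral is finite, \<open>Lp_norm 2\<close> is
      \<open>ennreal\<close> of a real number and hence finite.\<close>
    finally show ?thesis
      by (simp add: Lp_norm_def Let_def)
  qed
  ultimately show ?thesis
    using u(1) unfolding H_space_def by blast
qed

end
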